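(* Let $G$ be a finite cyclic group of order at least $2000$. Then \[\Delta^{\ast}(G)\cap\mathbb N_{\ge |G|/10}=\bigcup_{m\mid |G|} I(m)\cap\mathbb N_{\ge |G|/10}.\]
   Context: $\mathbb N_{\ge a}=\{k\in\mathbb N:k\ge a\}$. For $G_0\subseteq G$: $\mathcal B(G_0)$ is the monoid of zero-sum sequences over $G_0$, whose atoms are the minimal zero-sum sequences; $\mathsf L(B)$ is the set of lengths of factorizations of $B$ into minimal zero-sum sequences; for $L=\{\ell_1<\dots<\ell_k\}$, $\Delta(L)=\{\ell_{i+1}-\ell_i\}$; $\Delta(G_0)=\bigcup_B\Delta(\mathsf L(B))$; $\min\Delta(G_0)$ is its minimum. $\Delta^{\ast}(G)=\{\min\Delta(G_0):G_0\subseteq G,\ \Delta(G_0)\ne\emptyset\}$. For a positive integer $n$: $M(n)$ is the set of triples $(c_1,c_2,d)$ of positive integers with $c_1,c_2\in[1,n]$, $d\mid n$, such that $\frac{n-c_1-c_2}{c_1c_2}$ and $\frac{(n-c_1-c_2)d}{c_2n}$ are positive integers; $I(n)$ is the set of all integers $\gcd\left\{\frac{n-c_1-c_2}{c_1c_2},\frac{(n-c_1-c_2)d}{c_2n}\right\}$ with $(c_1,c_2,d)\in M(n)$. *)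

theory Defs
  imports "HOL-Algebra.Elementary_Groups" "HOL-Algebra.FiniteProduct" "HOL-Library.Multiset" Complex_Main
begin

text \<open>
  The ambient abelian group is a multiplicative HOL-Algebra structure, so ``zero-sum''
  reads ``product equal to the identity''. A sequence over \<open>G\<^sub>0\<close> (unordered, repetition
  allowed) is a finite multiset, and the product of sequences is multiset union.
\<close>

definition seq_sum :: "('a, 'b) monoid_scheme \<Rightarrow> 'a multiset \<Rightarrow> 'a" where
  "seq_sum G S = finprod G (\<lambda>g. g [^]\<^bsub>G\<^esub> count S g) (set_mset S)"

definition zero_sum_seqs :: "('a, 'b) monoid_scheme \<Rightarrow> 'a set \<Rightarrow> 'a multiset set" where
  "zero_sum_seqs G G0 = {S. set_mset S \<subseteq> G0 \<and> seq_sum G S = \<one>\<^bsub>G\<^esub>}"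

definition minimal_zero_sum_seqs :: "('a, 'b) monoid_scheme \<Rightarrow> 'a set \<Rightarrow> 'a multiset set" where
  "minimal_zero_sum_seqs G G0 =
     {S \<in> zero_sum_seqs G G0. S \<noteq> {#} \<and>
        (\<forall>T. T \<subset># S \<and> T \<noteq> {#} \<longrightarrow> seq_sum G T \<noteq> \<one>\<^bsub>G\<^esub>)}"

text \<open>
  Factorizations are taken up to order, i.e. as multisets of atoms; the empty
  sequence has the empty factorization, of length \<open>0\<close>.
\<close>

definition lengths :: "('a, 'b) monoid_scheme \<Rightarrow> 'a set \<Rightarrow> 'a multiset \<Rightarrow> nat set" where
  "lengths G G0 B =
     {size F | F. set_mset F \<subseteq> minimal_zero_sum_seqs G G0 \<and> \<Sum>\<^sub># F = B}"

definition distances :: "nat set \<Rightarrow> nat set" where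
  "distances L = {l' - l | l l'. l \<in> L \<and> l' \<in> L \<and> l < l' \<and> L \<inter> {l<..<l'} = {}}"

definition Delta :: "('a, 'b) monoid_scheme \<Rightarrow> 'a set \<Rightarrow> nat set" where
  "Delta G G0 = (\<Union>B \<in> zero_sum_seqs G G0. distances (lengths G G0 B))"

definition Delta_star :: "('a, 'b) monoid_scheme \<Rightarrow> nat set" where
  "Delta_star G =
     {(LEAST d. d \<in> Delta G G0) | G0. G0 \<subseteq> carrier G \<and> Delta G G0 \<noteq> {}}"

text \<open>
  The two fractions are formed in \<^typ>\<open>rat\<close>: neither the subtraction nor the division
  is truncated.
\<close>

definition frac1 :: "nat \<Rightarrow> nat \<Rightarrow> nat \<Rightarrow> rat" where
  "frac1 n c1 c2 = (of_nat n - of_nat c1 - of_nat c2) / (of_nat c1 * of_nat c2)"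

definition frac2 :: "nat \<Rightarrow> nat \<Rightarrow> nat \<Rightarrow> nat \<Rightarrow> rat" where
  "frac2 n c1 c2 d =
     ((of_nat n - of_nat c1 - of_nat c2) * of_nat d) / (of_nat c2 * of_nat n)"

definition M_set :: "nat \<Rightarrow> (nat \<times> nat \<times> nat) set" where
  "M_set n = {(c1, c2, d). c1 \<in> {1..n} \<and> c2 \<in> {1..n} \<and> 0 < d \<and> d dvd n \<and>
            frac1 n c1 c2 \<in> \<nat> - {0} \<and> frac2 n c1 c2 d \<in> \<nat> - {0}}"

definition I_set :: "nat \<Rightarrow> nat set" where
  "I_set n = {gcd a b | a b c1 c2 d. (c1, c2, d) \<in> M_set n \<and>
            of_nat a = frac1 n c1 c2 \<and> of_nat b = frac2 n c1 c2 d}"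

end

theory Submission
  imports Defs "HOL-Algebra.Multiplicative_Group" "HOL-Number_Theory.Cong"
begin

text \<open>
  Write \<open>n = |G|\<close> and \<open>v = min \<Delta>(G\<^sub>0)\<close>; all factorization lengths of a zero-sum sequence over \<open>G\<^sub>0\<close>
  are congruent modulo \<open>v\<close>. Relative to a base \<open>e\<close> a zero-sum sequence has an index: the sum of the
  discrete logarithms of its terms divided by the order of \<open>e\<close>.

  Given \<open>(c\<^sub>1, c\<^sub>2, d) \<in> M(m)\<close>, the integer \<open>a = (m - c\<^sub>1) / c\<^sub>2\<close> is a unit modulo \<open>m\<close>, and one takes
  \<open>G\<^sub>0 = {e, a e, d e}\<close> with \<open>e\<close> of order \<open>m\<close>. Every minimal zero-sum sequence over \<open>G\<^sub>0\<close> has index \<open>1\<close>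
  relative to \<open>e\<close> or relative to \<open>a e\<close>, and the two indices agree modulo the greatest common divisor
  of the two fractions. Hence all lengths are congruent modulo this number, and explicit sequences
  of index \<open>1\<close> relative to \<open>a e\<close> show that it is optimal.

  Conversely let \<open>v \<ge> n / 10\<close>. Two elements \<open>g\<close>, \<open>h\<close> generating subgroups that meet in a group of
  order \<open>\<gamma>\<close> have multiples generating this intersection, whose quotient is a unit \<open>a\<close> modulo \<open>\<gamma>\<close>.
  If \<open>a = 1\<close> for all pairs, then the Chinese remainder theorem
  turns the sum of the inverse orders into an additive integral index, and a sequence of index at
  least \<open>2\<close> produces a difference of lengths below the number of divisors of \<open>n\<close>, which is too
  small. If \<open>a \<noteq> 1\<close>, three relations suffice to see that \<open>\<gamma> = q (1 + r s v) + r\<close> and \<open>a = 1 + r s v\<close>.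
  As \<open>v\<close> is large, only finitely many \<open>(n / \<gamma>, q, r, s)\<close> remain, and each of them gives
  \<open>v \<in> I(m)\<close> for some \<open>m\<close> dividing \<open>n\<close> unless \<open>n = c s v + c + 1\<close> for a few pairs \<open>(c, s)\<close> with
  \<open>s \<nmid> c + 1\<close>. In these cases the elements of \<open>G\<^sub>0\<close> other than \<open>e\<close> and \<open>a e\<close> have orders dividing
  \<open>c + 1\<close>, and the comparison of the two indices gives \<open>s v \<mid> (c + 1) v\<close>, a contradiction.
\<close>

subsection \<open>Zero-sum sequences and discrete logarithms\<close>

text \<open>For a discrete logarithm \<open>L\<close> to base \<open>e\<close>, a sequence is
  zero-sum iff \<open>ord e\<close> divides its weight; the quotient is its index.\<close>

definition wt :: "('a \<Rightarrow> nat) \<Rightarrow> 'a multiset \<Rightarrow> nat" where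
  "wt L S = (\<Sum>x\<in>#S. L x)"

lemma wt_simps [simp]:
  "wt L {#} = 0" "wt L (add_mset x S) = L x + wt L S" "wt L (S + T) = wt L S + wt L T"
  "wt L (replicate_mset k x) = k * L x"
  by (simp_all add: wt_def)

lemma wt_sum: "finite I \<Longrightarrow> wt L (\<Sum>i\<in>I. A i) = (\<Sum>i\<in>I. wt L (A i))"
  by (induction I rule: finite_induct) auto

lemma wt_diff: "T \<subseteq># S \<Longrightarrow> wt L (S - T) + wt L T = wt L S"
  by (metis subset_mset.diff_add wt_simps(3))

lemma wt_cong: "(\<And>x. x \<in># S \<Longrightarrow> L x = L' x) \<Longrightarrow> wt L S = wt L' S"
  unfolding wt_def by (metis image_mset_cong)

lemma wt_eq_0_iff: "wt L S = 0 \<longleftrightarrow> (\<forall>x\<in>#S. L x = 0)"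
  by (induction S) auto

lemma wt_conv_sum: "finite A \<Longrightarrow> set_mset S \<subseteq> A \<Longrightarrow> wt L S = (\<Sum>x\<in>A. L x * count S x)"
proof (induction S)
  case (add x S)
  have "(\<Sum>y\<in>A. L y * count (add_mset x S) y) =
        (\<Sum>y\<in>A. L y * count S y + (if y = x then L x else 0))"
    by (intro sum.cong) auto
  also have "\<dots> = wt L S + L x"
    using add by (simp add: sum.distrib)
  finally show ?case by simp
qed auto

text \<open>The logarithm is any exponent, not a residue, so convenient representatives can be
  chosen; the base may lie outside \<open>G0\<close>.\<close>

locale log_base = comm_group G for G :: "('a, 'b) monoid_scheme" (structure) +
  fixes G0 :: "'a set" and e :: 'a and L :: "'a \<Rightarrow> nat"
  assumes base_closed: "e \<in> carrier G" and base_ord: "ord e > 0"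
    and log: "x \<in> G0 \<Longrightarrow> e [^] L x = x"
begin

lemma seq_sum_log:
  assumes "set_mset S \<subseteq> G0"
  shows "seq_sum G S = e [^] wt L S"
proof -
  have fin: "finprod G (\<lambda>g. e [^] f g) A = e [^] sum f A" if "finite A" for f :: "'a \<Rightarrow> nat" and A
    using that
    by (induction A rule: finite_induct) (auto simp: base_closed nat_pow_mult)
  have "seq_sum G S = finprod G (\<lambda>g. e [^] (L g * count S g)) (set_mset S)"
    unfolding seq_sum_def
  proof (rule finprod_cong')
    fix g assume "g \<in> set_mset S"
    with assms have "e [^] L g = g" using log by blast
    then show "g [^] count S g = e [^] (L g * count S g)"
      using base_closed by (metis nat_pow_pow)
  qed (use base_closed in auto)
  also have "\<dots> = e [^] wt L S"
    by (simp add: fin wt_conv_sum[of "set_mset S" S])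
  finally show ?thesis .
qed

lemma seq_sum_eq_one_iff:
  "set_mset S \<subseteq> G0 \<Longrightarrow> seq_sum G S = \<one> \<longleftrightarrow> ord e dvd wt L S"
  by (simp add: seq_sum_log pow_eq_id base_closed)

lemma zero_sum_iff:
  "S \<in> zero_sum_seqs G G0 \<longleftrightarrow> set_mset S \<subseteq> G0 \<and> ord e dvd wt L S"
  unfolding zero_sum_seqs_def using seq_sum_eq_one_iff by auto

lemma atom_iff:
  "A \<in> minimal_zero_sum_seqs G G0 \<longleftrightarrow> set_mset A \<subseteq> G0 \<and> A \<noteq> {#} \<and> ord e dvd wt L A \<and>
     (\<forall>T. T \<subseteq># A \<and> T \<noteq> {#} \<and> ord e dvd wt L T \<longrightarrow> T = A)"
proof -
  have "seq_sum G T = \<one> \<longleftrightarrow> ord e dvd wt L T" if "set_mset A \<subseteq> G0" "T \<subseteq># A" for T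
    using that by (intro seq_sum_eq_one_iff) (meson order_trans set_mset_mono)
  then show ?thesis
    unfolding minimal_zero_sum_seqs_def
    by (auto simp: zero_sum_iff subset_mset.less_le)
qed

lemma atom_eqI:
  "A \<in> minimal_zero_sum_seqs G G0 \<Longrightarrow> T \<subseteq># A \<Longrightarrow> T \<noteq> {#} \<Longrightarrow> ord e dvd wt L T \<Longrightarrow> T = A"
  by (auto simp: atom_iff)

text \<open>As all logarithms are positive, a nonempty zero-sum subsequence already weighs at least
  \<open>ord e\<close>, so its complement has weight \<open>0\<close> and is empty.\<close>

lemma atomI:
  assumes "set_mset A \<subseteq> G0" "wt L A = ord e" "\<And>x. x \<in># A \<Longrightarrow> L x > 0"
  shows "A \<in> minimal_zero_sum_seqs G G0"
  unfolding atom_iff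
proof (intro conjI allI impI)
  show "A \<noteq> {#}" using assms base_ord by auto
  fix T assume T: "T \<subseteq># A \<and> T \<noteq> {#} \<and> ord e dvd wt L T"
  then have "wt L T \<noteq> 0"
    by (metis assms(3) mset_subset_eqD multiset_nonemptyE not_gr_zero wt_eq_0_iff)
  with T have "wt L T \<ge> ord e" by (meson dvd_imp_le not_gr_zero)
  moreover have "wt L (A - T) + wt L T = ord e" using T assms by (simp add: wt_diff)
  ultimately have "wt L (A - T) = 0" by linarith
  then have "A - T = {#}"
    by (metis assms(3) in_diffD multiset_nonemptyE not_gr_zero wt_eq_0_iff)
  with T show "T = A" by (simp add: Diff_eq_empty_iff_mset subset_mset.antisym)
qed (use assms in auto)

text \<open>A nonempty zero-sum subsequence of least size is an atom; split it off and
  induct.\<close>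

lemma lengths_nonempty:
  assumes "B \<in> zero_sum_seqs G G0"
  shows "lengths G G0 B \<noteq> {}"
  using assms
proof (induction "size B" arbitrary: B rule: less_induct)
  case less
  show ?case
  proof (cases "B = {#}")
    case True
    then show ?thesis unfolding lengths_def by (auto intro!: exI[of _ "{#}"])
  next
    case B: False
    define N where "N T \<longleftrightarrow> T \<subseteq># B \<and> T \<noteq> {#} \<and> ord e dvd wt L T" for T
    have "N B" using B less.prems unfolding N_def by (auto simp: zero_sum_iff)
    then obtain A where A: "N A" and min: "\<And>T. N T \<Longrightarrow> size A \<le> size T"
      using ex_has_least_nat[of N B size] by blast
    have "T = A" if "T \<subseteq># A" "T \<noteq> {#}" "ord e dvd wt L T" for T
    proof -
      have "N T" using that A unfolding N_def by auto
      then show ?thesis using min that by (metis mset_subset_size not_le subset_mset.le_neq_trans)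
    qed
    moreover have "set_mset A \<subseteq> G0"
      using A less.prems unfolding N_def zero_sum_iff by (meson order_trans set_mset_mono)
    ultimately have atom: "A \<in> minimal_zero_sum_seqs G G0"
      using A unfolding N_def atom_iff by blast
    have sum: "wt L (B - A) + wt L A = wt L B" using A wt_diff unfolding N_def by blast
    have "B - A \<in> zero_sum_seqs G G0"
      using less.prems A sum unfolding zero_sum_iff N_def
      by (metis dvd_add_left_iff in_diffD subset_iff)
    moreover have "size (B - A) < size B"
      using A unfolding N_def by (metis add_diff_cancel_right' mset_subset_size size_Diff_submset
          diff_less nonempty_has_size size_mset_mono less_le_trans)
    ultimately obtain F where F: "set_mset F \<subseteq> minimal_zero_sum_seqs G G0" "\<Sum>\<^sub># F = B - A"
      using less.hyps[of "B - A"] unfolding lengths_def by auto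
    have "\<Sum>\<^sub># (add_mset A F) = B" using F A unfolding N_def by simp
    then show ?thesis
      using F atom unfolding lengths_def by (auto intro!: exI[of _ "add_mset A F"])
  qed
qed

lemma lengths_zero_sum: "l \<in> lengths G G0 B \<Longrightarrow> B \<in> zero_sum_seqs G G0"
proof -
  assume "l \<in> lengths G G0 B"
  then obtain F where F: "set_mset F \<subseteq> minimal_zero_sum_seqs G G0" "\<Sum>\<^sub># F = B"
    unfolding lengths_def by auto
  from F(1) have "\<Sum>\<^sub># F \<in> zero_sum_seqs G G0"
    by (induction F) (auto simp: zero_sum_iff atom_iff)
  with F show ?thesis by simp
qed

end

section \<open>Lengths, distances and the minimum of Delta\<close>

lemma lengths_add:
  assumes "l \<in> lengths G G0 B" "l' \<in> lengths G G0 B'"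
  shows "l + l' \<in> lengths G G0 (B + B')"
proof -
  obtain F F' where "set_mset F \<subseteq> minimal_zero_sum_seqs G G0" "\<Sum>\<^sub># F = B" "l = size F"
    "set_mset F' \<subseteq> minimal_zero_sum_seqs G G0" "\<Sum>\<^sub># F' = B'" "l' = size F'"
    using assms unfolding lengths_def by auto
  then show ?thesis unfolding lengths_def by (auto intro!: exI[of _ "F + F'"])
qed

lemma lengths_atom: "A \<in> minimal_zero_sum_seqs G G0 \<Longrightarrow> Suc 0 \<in> lengths G G0 A"
  unfolding lengths_def by (auto intro!: exI[of _ "{#A#}"])

lemma lengths_repeat: "l \<in> lengths G G0 B \<Longrightarrow> k * l \<in> lengths G G0 (repeat_mset k B)"
proof (induction k)
  case 0 then show ?case unfolding lengths_def by (auto intro!: exI[of _ "{#}"])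
next
  case (Suc k) then show ?case using lengths_add by fastforce
qed

lemma distances_le:
  assumes "l \<in> X" "l' \<in> X" "l < l'"
  shows "\<exists>d \<in> distances X. d \<le> l' - l"
proof -
  define k where "k = (LEAST k. k \<in> X \<and> l < k)"
  have k: "k \<in> X \<and> l < k" unfolding k_def by (rule LeastI[of _ l']) (use assms in auto)
  have "k \<le> l'" unfolding k_def using assms by (intro Least_le) auto
  moreover have "X \<inter> {l<..<k} = {}"
    using not_less_Least[of _ "\<lambda>k. k \<in> X \<and> l < k"] unfolding k_def[symmetric] by auto
  ultimately show ?thesis using k assms
    unfolding distances_def by (intro bexI[of _ "k - l"]) auto
qed

context log_base
begin

text \<open>Let \<open>v\<close> be the difference of two lengths of \<open>B0\<close>. If two
  lengths differ by \<open>q * v + r\<close>, multiplying by \<open>q\<close> copies of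
  \<open>B0\<close>, factored in the two ways, leaves lengths that differ by \<open>r\<close> only;
  minimality of \<open>v\<close> forces \<open>r = 0\<close>.\<close>

lemma least_Delta_dvd:
  assumes ne: "Delta G G0 \<noteq> {}" and l: "l \<in> lengths G G0 B" "l' \<in> lengths G G0 B"
  shows "[l = l'] (mod (LEAST d. d \<in> Delta G G0))"
proof -
  define v where "v = (LEAST d. d \<in> Delta G G0)"
  have "v \<in> Delta G G0" unfolding v_def using ne by (metis LeastI ex_in_conv)
  then obtain B0 l0 l0' where 0: "l0 \<in> lengths G G0 B0" "l0' \<in> lengths G G0 B0" "l0 < l0'" "v = l0' - l0"
    unfolding Delta_def distances_def by auto
  have min: "v \<le> k' - k" if k: "k \<in> lengths G G0 B" "k' \<in> lengths G G0 B" "k < k'" for k k' B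
  proof -
    obtain d where "d \<in> distances (lengths G G0 B)" "d \<le> k' - k"
      using distances_le[OF k] by blast
    moreover have "d \<in> Delta G G0"
      using calculation lengths_zero_sum[OF k(1)] unfolding Delta_def by blast
    ultimately show ?thesis unfolding v_def by (meson Least_le order_trans)
  qed
  have dvd: "v dvd k' - k" if k: "k \<in> lengths G G0 B" "k' \<in> lengths G G0 B" "k < k'" for k k' B
  proof (rule ccontr)
    assume "\<not> v dvd k' - k"
    define q r where "q = (k' - k) div v" and "r = (k' - k) mod v"
    have "v > 0" using 0 by simp
    then have r: "0 < r" "r < v"
      using \<open>\<not> v dvd k' - k\<close> unfolding r_def by (auto simp: mod_greater_zero_iff_not_dvd)
    have kk: "k' - k = q * v + r" unfolding q_def r_def by simp
    have "k + q * l0' \<in> lengths G G0 (B + repeat_mset q B0)"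
      "k' + q * l0 \<in> lengths G G0 (B + repeat_mset q B0)"
      using k 0 by (auto intro!: lengths_add lengths_repeat)
    moreover have eq: "k' + q * l0 = k + q * l0' + r"
    proof -
      have "l0' = l0 + v" "k' = k + q * v + r" using 0 kk k by auto
      then show ?thesis by (simp add: algebra_simps)
    qed
    ultimately have "v \<le> k' + q * l0 - (k + q * l0')"
      using r by (intro min) auto
    then show False using eq r by simp
  qed
  show ?thesis
    unfolding v_def[symmetric]
  proof (cases l l' rule: linorder_cases)
    case less
    then show "[l = l'] (mod v)"
      using dvd[OF l] by (intro cong_sym[OF iffD2[OF cong_altdef_nat]]) auto
  next
    case greater
    then show "[l = l'] (mod v)"
      using dvd[OF l(2,1)] by (intro iffD2[OF cong_altdef_nat]) auto
  qed simp
qed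

lemma least_Delta_pos:
  assumes "Delta G G0 \<noteq> {}"
  shows "\<exists>B l. l \<in> lengths G G0 B \<and> l + (LEAST d. d \<in> Delta G G0) \<in> lengths G G0 B"
    and "(LEAST d. d \<in> Delta G G0) > 0"
proof -
  have "(LEAST d. d \<in> Delta G G0) \<in> Delta G G0" using assms by (metis LeastI ex_in_conv)
  then show "\<exists>B l. l \<in> lengths G G0 B \<and> l + (LEAST d. d \<in> Delta G G0) \<in> lengths G G0 B"
    and "(LEAST d. d \<in> Delta G G0) > 0"
    unfolding Delta_def distances_def by force+
qed

end

subsection \<open>Sets with two bases\<close>

lemma replicate_mset_add: "replicate_mset (j + k) x = replicate_mset j x + replicate_mset k x"
  by (induction j) auto

lemma dvd_wt: "(\<And>x. x \<in># S \<Longrightarrow> d dvd k * L x) \<Longrightarrow> d dvd k * wt L S"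
  by (induction S) (auto simp: distrib_left)

lemma repeat_replicate_mset: "repeat_mset j (replicate_mset k x) = replicate_mset (j * k) x"
  by (intro multiset_eqI) simp

context log_base
begin

text \<open>
  For \<open>U = e\<^sup>n\<close> the sequences \<open>x e\<^bsup>n - log x\<^esup>\<close> are atoms, and \<open>A U\<^bsup>|A|\<^esup>\<close> is the product of those with \<open>x\<close>
  in \<open>A\<close>, times \<open>U\<^sup>t\<close>.
\<close>
lemma atom_lengths:
  assumes e: "e \<in> G0" "L e = 1" and L: "\<And>x. x \<in> G0 \<Longrightarrow> 0 < L x \<and> L x \<le> ord e"
    and A: "A \<in> minimal_zero_sum_seqs G G0" "wt L A = t * ord e"
  shows "\<exists>B. 1 + size A \<in> lengths G G0 B \<and> size A + t \<in> lengths G G0 B"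
proof -
  define U where "U = replicate_mset (ord e) e"
  define P where "P x = add_mset x (replicate_mset (ord e - L x) e)" for x
  have sub: "set_mset A \<subseteq> G0" using A by (simp add: atom_iff)
  have U: "U \<in> minimal_zero_sum_seqs G G0"
    unfolding U_def using e by (intro atomI) (auto split: if_splits)
  have P: "P x \<in> minimal_zero_sum_seqs G G0" if "x \<in> G0" for x
    unfolding P_def using e L[OF that] that by (intro atomI) (auto split: if_splits)
  have sumP: "\<Sum>\<^sub># (image_mset P S) + replicate_mset (wt L S) e
      = S + replicate_mset (size S * ord e) e" if "set_mset S \<subseteq> G0" for S
    using that
  proof (induction S)
    case (add x S)
    then have "L x \<le> ord e" using L by auto
    then have Px: "P x + replicate_mset (L x) e = {#x#} + replicate_mset (ord e) e"
      unfolding P_def by (simp flip: replicate_mset_add)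
    have "\<Sum>\<^sub># (image_mset P (add_mset x S)) + replicate_mset (wt L (add_mset x S)) e =
        (P x + replicate_mset (L x) e) + (\<Sum>\<^sub># (image_mset P S) + replicate_mset (wt L S) e)"
      by (simp add: replicate_mset_add)
    also have "\<dots> = ({#x#} + replicate_mset (ord e) e) + (S + replicate_mset (size S * ord e) e)"
      using add Px by simp
    also have "\<dots> = add_mset x S + replicate_mset (size (add_mset x S) * ord e) e"
      by (simp add: replicate_mset_add)
    finally show ?case .
  qed auto
  have eq: "A + repeat_mset (size A) U = \<Sum>\<^sub># (image_mset P A) + repeat_mset t U"
    using sumP[OF sub] A unfolding U_def by (simp add: repeat_replicate_mset)
  have "1 + size A * 1 \<in> lengths G G0 (A + repeat_mset (size A) U)"
    using lengths_atom[OF A(1)] lengths_atom[OF U] by (intro lengths_add lengths_repeat) auto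
  moreover have "size A \<in> lengths G G0 (\<Sum>\<^sub># (image_mset P A))"
  proof -
    have "set_mset (image_mset P A) \<subseteq> minimal_zero_sum_seqs G G0" using P sub by auto
    then show ?thesis unfolding lengths_def by (auto intro!: exI[of _ "image_mset P A"])
  qed
  then have "size A + t * 1 \<in> lengths G G0 (A + repeat_mset (size A) U)"
    unfolding eq using lengths_atom[OF U] by (intro lengths_add lengths_repeat) auto
  ultimately show ?thesis by auto
qed

text \<open>The index is additive, so every factorization of \<open>B\<close> of length
  \<open>l\<close> shows that \<open>k\<close> times the index of \<open>B\<close> is
  \<open>k * l\<close> modulo \<open>g\<close>.\<close>

lemma lengths_cong:
  assumes "\<And>A. A \<in> minimal_zero_sum_seqs G G0 \<Longrightarrow> [k * (wt L A div ord e) = k] (mod g)"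
    and "l \<in> lengths G G0 B" "l' \<in> lengths G G0 B"
  shows "[k * l = k * l'] (mod g)"
proof -
  have *: "[k * (wt L (\<Sum>\<^sub># F) div ord e) = k * size F] (mod g)"
    if "set_mset F \<subseteq> minimal_zero_sum_seqs G G0" for F
    using that
  proof (induction F)
    case (add A F)
    have "ord e dvd wt L A" using add.prems by (auto simp: atom_iff)
    then have "k * (wt L (\<Sum>\<^sub># (add_mset A F)) div ord e) =
        k * (wt L A div ord e) + k * (wt L (\<Sum>\<^sub># F) div ord e)"
      by (simp add: div_plus_div_distrib_dvd_left algebra_simps)
    also have "[\<dots> = k + k * size F] (mod g)"
      using add assms(1) by (intro cong_add) auto
    finally show ?case by simp
  qed auto
  from assms(2,3) obtain F F' where F: "set_mset F \<subseteq> minimal_zero_sum_seqs G G0" "\<Sum>\<^sub># F = B" "size F = l"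
    "set_mset F' \<subseteq> minimal_zero_sum_seqs G G0" "\<Sum>\<^sub># F' = B" "size F' = l'"
    unfolding lengths_def by auto
  have "[k * (wt L B div ord e) = k * l] (mod g)" "[k * (wt L B div ord e) = k * l'] (mod g)"
    using *[OF F(1)] *[OF F(4)] F by simp_all
  then show ?thesis using cong_sym cong_trans by blast
qed

end

lemma divisor_chain_subset:
  fixes L :: "'a \<Rightarrow> nat"
  assumes "\<And>x. x \<in># S \<Longrightarrow> L x dvd m"
    and "\<And>x y. x \<in># S \<Longrightarrow> y \<in># S \<Longrightarrow> L x \<le> L y \<Longrightarrow> L x dvd L y"
    and "m \<le> wt L S"
  shows "\<exists>T. T \<subseteq># S \<and> wt L T = m"
  using assms
proof (induction "size S" arbitrary: S)
  case 0
  then show ?case by auto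
next
  case (Suc k)
  then have "S \<noteq> {#}" by auto
  \<comment> \<open>a least weight divides \<open>m\<close> and all other weights, so removing it cannot skip the value \<open>m\<close>\<close>
  then obtain x where x: "x \<in># S" "\<And>y. y \<in># S \<Longrightarrow> L x \<le> L y"
    using ex_has_least_nat[of "\<lambda>x. x \<in># S" _ L] by blast
  obtain S' where S': "S = add_mset x S'" using x(1) by (metis insert_DiffM)
  show ?case
  proof (cases "m \<le> wt L S'")
    case True
    have "\<exists>T. T \<subseteq># S' \<and> wt L T = m"
      by (rule Suc.hyps(1)) (use Suc S' True in auto)
    then obtain T where "T \<subseteq># S'" "wt L T = m" by blast
    then show ?thesis unfolding S'
      by (intro exI[of _ T]) (auto simp: subseteq_mset_def le_SucI)
  next
    case False
    have "L x dvd wt L S'"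
      using dvd_wt[of S' "L x" 1 L] x Suc.prems(2) S' by simp
    moreover have "L x dvd m" using Suc.prems(1) x by blast
    ultimately have "L x dvd m - wt L S'" by (simp add: dvd_diff_nat)
    then have "L x \<le> m - wt L S'" using False by (intro dvd_imp_le) auto
    moreover have "m \<le> L x + wt L S'" using Suc.prems(3) S' by simp
    ultimately have "wt L S = m" using False S' by simp
    then show ?thesis by blast
  qed
qed

text \<open>Since \<open>(1 + c1 * t) * (1 + c2 * t) = 1 + m * t\<close>, the exponents that express
  \<open>h\<close> by \<open>e\<close> and \<open>e\<close> by \<open>h\<close> are inverse modulo
  \<open>m\<close>. All other elements have one logarithm for both bases, and these logarithms form
  a divisibility chain, as \<open>divisor_chain_subset\<close> requires.\<close>

locale two_base = E: log_base G G0 e L + H: log_base G G0 h L'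
  for G :: "('a, 'b) monoid_scheme" (structure) and G0 e L h L' +
  fixes m c1 c2 t :: nat
  assumes m: "m = c1 * c2 * t + c1 + c2" and ords: "group.ord G e = m" "group.ord G h = m"
    and pos: "c1 > 0" "c2 > 0" "t > 0"
    and mem: "e \<in> G0" "h \<in> G0" "e \<noteq> h"
    and L: "L e = 1" "L h = 1 + c1 * t" "L' h = 1" "L' e = 1 + c2 * t"
    and L_rest: "f \<in> G0 - {e, h} \<Longrightarrow> L' f = L f \<and> L f > 0 \<and> L f dvd m"
    and L_chain: "f \<in> G0 - {e, h} \<Longrightarrow> f' \<in> G0 - {e, h} \<Longrightarrow> L f \<le> L f' \<Longrightarrow> L f dvd L f'"
begin

definition rest :: "'a multiset \<Rightarrow> 'a multiset" where
  "rest A = filter_mset (\<lambda>x. x \<notin> {e, h}) A"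

lemma decompose: "A = replicate_mset (count A e) e + replicate_mset (count A h) h + rest A"
  using mem(3) by (intro multiset_eqI) (auto simp: rest_def)

lemma wt_rest: "set_mset A \<subseteq> G0 \<Longrightarrow> wt L' (rest A) = wt L (rest A)"
  using L_rest by (intro wt_cong) (auto simp: rest_def)

lemma wt_e: "wt L A = count A e + count A h * (1 + c1 * t) + wt L (rest A)"
  using arg_cong[OF decompose[of A], of "wt L"] by (simp add: L)

lemma wt_h:
  "set_mset A \<subseteq> G0 \<Longrightarrow> wt L' A = count A e * (1 + c2 * t) + count A h + wt L (rest A)"
  using arg_cong[OF decompose[of A], of "wt L'"] by (simp add: L wt_rest)

text \<open>For zero-sum \<open>A\<close>, division by \<open>m\<close> compares the indices of
  \<open>A\<close> to the two bases.\<close>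

lemma wt_relation:
  assumes "set_mset A \<subseteq> G0"
  shows "(1 + c1 * t) * wt L' A = wt L A + m * (t * count A e) + c1 * t * wt L (rest A)"
  unfolding wt_e[of A] wt_h[OF assms] m by (simp add: algebra_simps)

lemma L_pos: "x \<in> G0 \<Longrightarrow> L x > 0"
  using L L_rest[of x] by (cases "x \<in> {e, h}") auto

lemma swapped: "two_base G G0 h L' e L m c2 c1 t"
proof (intro two_base.intro two_base_axioms.intro H.log_base_axioms E.log_base_axioms)
  show "m = c2 * c1 * t + c2 + c1" using m by simp
  show "f \<in> G0 - {h, e} \<Longrightarrow> L f = L' f \<and> L' f > 0 \<and> L' f dvd m" for f
    using L_rest[of f] by auto
  show "f \<in> G0 - {h, e} \<Longrightarrow> f' \<in> G0 - {h, e} \<Longrightarrow> L' f \<le> L' f' \<Longrightarrow> L' f dvd L' f'" for f f'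
    using L_rest[of f] L_rest[of f'] L_chain[of f f'] by auto
  show "h \<noteq> e" using mem(3) by metis
qed (fact ords pos mem L)+

text \<open>A subsequence of weight exactly \<open>m\<close> is zero-sum and hence all of
  \<open>A\<close>. If the terms other than \<open>e\<close> and \<open>h\<close> weigh at least
  \<open>m\<close>, the divisor chain provides one; otherwise copies of \<open>e\<close> fill the
  gap, unless the index is \<open>1\<close> anyway.\<close>

lemma atom_few:
  assumes A: "A \<in> minimal_zero_sum_seqs G G0" and "count A h < c2"
  shows "wt L A = m"
proof -
  have sub: "set_mset A \<subseteq> G0" and ne: "A \<noteq> {#}" and dvd: "m dvd wt L A"
    using A ords by (auto simp: E.atom_iff)
  have restA: "rest A \<subseteq># A" unfolding rest_def by simp
  have setrest: "set_mset (rest A) \<subseteq> G0 - {e, h}" using sub unfolding rest_def by auto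
  have "m > 0" using m pos by simp
  have eqI: "wt L A = m" if "T \<subseteq># A" "wt L T = m" for T
  proof -
    have "T \<noteq> {#}" using that \<open>m > 0\<close> by auto
    then have "T = A" using E.atom_eqI[OF A that(1)] that ords by auto
    then show ?thesis using that by simp
  qed
  show ?thesis
  proof (cases "m \<le> wt L (rest A)")
    case True
    have "\<exists>T. T \<subseteq># rest A \<and> wt L T = m"
      using setrest L_rest L_chain True by (intro divisor_chain_subset) blast+
    then obtain T where T: "T \<subseteq># rest A" "wt L T = m" by blast
    show ?thesis using subset_mset.order_trans[OF T(1) restA] T(2) by (rule eqI)
  next
    case False
    obtain i where i: "wt L A = m * i" using dvd by blast
    have "wt L A \<noteq> 0" using ne sub L_pos wt_eq_0_iff
      by (metis multiset_nonemptyE not_gr_zero subsetD)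
    then have "i \<noteq> 0" using i by auto
    show ?thesis
    proof (cases "i = 1")
      \<comment> \<open>an index of at least \<open>2\<close> forces so many copies of \<open>e\<close> that \<open>e\<close> and the rest alone reach weight \<open>m\<close>\<close>
      case False
      then have "2 * m \<le> wt L A" using i \<open>i \<noteq> 0\<close> by (simp add: mult.commute)
      moreover have "count A h * (1 + c1 * t) < m"
      proof -
        \<comment> \<open>The right-hand side equals \<open>m - c1\<close>.\<close>
        have "count A h * (1 + c1 * t) \<le> c2 * (1 + c1 * t)" using assms by (intro mult_right_mono) auto
        then show ?thesis using m pos by (simp add: algebra_simps)
      qed
      ultimately have "m - wt L (rest A) \<le> count A e" using wt_e[of A] by linarith
      then have "replicate_mset (m - wt L (rest A)) e + rest A \<subseteq># A"
        by (intro mset_subset_eqI) (auto simp: rest_def)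
      moreover have "wt L (replicate_mset (m - wt L (rest A)) e + rest A) = m"
        using L \<open>\<not> m \<le> wt L (rest A)\<close> by simp
      ultimately show ?thesis by (rule eqI)
    qed (use i in auto)
  qed
qed

lemma atom_wt:
  assumes A: "A \<in> minimal_zero_sum_seqs G G0"
  shows "wt L A = m \<or> wt L' A = m"
proof -
  interpret swap: two_base G G0 h L' e L m c2 c1 t by (rule swapped)
  consider "count A h < c2" | "count A e < c1" | "c2 \<le> count A h" "c1 \<le> count A e" by linarith
  then show ?thesis
  proof cases
    case 3
    \<comment> \<open>The sequence \<open>e^c1 h^c2\<close> has weight
      \<open>c1 + c2 * (1 + c1 * t) = m\<close>, so an atom containing it coincides with it.\<close>
    define T where "T = replicate_mset c1 e + replicate_mset c2 h"
    have wtT: "wt L T = m" unfolding T_def by (simp add: L m algebra_simps)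
    have "T \<subseteq># A" unfolding T_def using 3 mem by (intro mset_subset_eqI) auto
    moreover have "T \<noteq> {#}" unfolding T_def using pos by auto
    ultimately have "T = A" using E.atom_eqI[OF A, of T] wtT ords by auto
    then show ?thesis using wtT by simp
  qed (use atom_few[OF A] swap.atom_few[OF A] in auto)
qed

text \<open>An atom of index \<open>1\<close> to base \<open>h\<close> satisfies
  \<open>wt_relation\<close> with left side \<open>(1 + c1 * t) * m\<close>. Multiplied by
  \<open>k\<close> and divided by \<open>m\<close>, this determines \<open>k\<close> times the index
  to base \<open>e\<close> modulo \<open>g\<close>; \<open>k\<close> clears the denominators coming
  from the remaining elements.\<close>

lemma lengths_cong_two_base:
  assumes g: "g dvd t" and rest_dvd: "\<And>f. f \<in> G0 - {e, h} \<Longrightarrow> m * g dvd k * (c1 * t * L f)"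
    and l: "l \<in> lengths G G0 B" "l' \<in> lengths G G0 B"
  shows "[k * l = k * l'] (mod g)"
proof (rule E.lengths_cong[OF _ l])
  fix A assume A: "A \<in> minimal_zero_sum_seqs G G0"
  then have sub: "set_mset A \<subseteq> G0" and dvd: "m dvd wt L A" using ords by (auto simp: E.atom_iff)
  have m0: "m > 0" using m pos by simp
  obtain i where i: "wt L A = m * i" using dvd by blast
  have idiv: "wt L A div group.ord G e = i" using i ords m0 by simp
  show "[k * (wt L A div group.ord G e) = k] (mod g)"
  proof (cases "wt L A = m")
    case True
    then show ?thesis using ords m0 by simp
  next
    case False
    then have "wt L' A = m" using atom_wt[OF A] by blast
    then have "(1 + c1 * t) * m = m * i + m * (t * count A e) + c1 * t * wt L (rest A)"
      using wt_relation[OF sub] i by simp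
    then have *: "k * ((1 + c1 * t) * m) =
        k * (m * i + m * (t * count A e)) + k * (c1 * t * wt L (rest A))"
      by (simp add: algebra_simps)
    have "m * g dvd k * (c1 * t) * wt L (rest A)"
      using rest_dvd sub by (intro dvd_wt) (auto simp: rest_def mult.assoc)
    then obtain r where r: "k * (c1 * t * wt L (rest A)) = m * g * r"
      unfolding dvd_def by (metis mult.assoc)
    have "m * (k * (1 + c1 * t)) = m * (k * i + k * t * count A e + g * r)"
      using * r by (simp add: algebra_simps)
    then have "k * (1 + c1 * t) = k * i + k * t * count A e + g * r"
      using m0 by (subst (asm) mult_cancel1) auto
    then have "k + k * c1 * t = k * i + (k * t * count A e + g * r)"
      by (simp add: algebra_simps)
    moreover have "[k + k * c1 * t = k + 0] (mod g)"
      using g by (intro cong_add) (auto simp: cong_0_iff)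
    moreover have "[k * i + (k * t * count A e + g * r) = k * i + 0] (mod g)"
      using g by (intro cong_add) (auto simp: cong_0_iff)
    ultimately show ?thesis unfolding idiv by (metis add.right_neutral cong_sym cong_trans)
  qed
qed

end

subsection \<open>Realizing the elements of \<open>I(m)\<close>\<close>

context comm_group
begin

lemma pow_inj:
  assumes "x \<in> carrier G" "x [^] (i::nat) = x [^] j" "i \<in> {1..ord x}" "j \<in> {1..ord x}"
  shows "i = j"
  using ord_inj'[OF assms(1)] assms(2-4) unfolding inj_on_def by blast

lemma pow_mod_ord: "x \<in> carrier G \<Longrightarrow> [i = j] (mod ord x) \<Longrightarrow> x [^] (i::nat) = x [^] j"
proof -
  assume x: "x \<in> carrier G" and "[i = j] (mod ord x)"
  have *: "x [^] k = x [^] (k mod ord x)" for k :: nat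
  proof -
    have "x [^] k = x [^] (ord x * (k div ord x)) \<otimes> x [^] (k mod ord x)"
      using x by (simp add: nat_pow_mult)
    also have "x [^] (ord x * (k div ord x)) = \<one>"
      using x by (subst pow_eq_id) auto
    finally show ?thesis using x by simp
  qed
  show ?thesis using *[of i] *[of j] \<open>[i = j] (mod ord x)\<close> by (simp add: cong_def)
qed

lemma ex_generator:
  assumes "cyclic_group G"
  shows "\<exists>z \<in> carrier G. ord z = order G"
  using assms cyclic_order_is_ord unfolding cyclic_group_def by fastforce

lemma ex_log:
  assumes z: "z \<in> carrier G" "ord z = order G" "finite (carrier G)" and x: "x \<in> carrier G"
  shows "\<exists>k \<in> {1..order G}. z [^] (k::nat) = x"
proof -
  have "card ((\<lambda>k::nat. z [^] k) ` {1..order G}) = card (carrier G)"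
    using ord_inj'[OF z(1)] z(2) by (simp add: card_image order_def)
  then have "(\<lambda>k::nat. z [^] k) ` {1..order G} = carrier G"
    using z by (intro card_subset_eq) auto
  then have "x \<in> (\<lambda>k::nat. z [^] k) ` {1..order G}" using x by simp
  then show ?thesis by (metis (no_types, lifting) imageE)
qed

text \<open>Here \<open>t\<close> and \<open>u\<close> are the two fractions of a triple in M(m),
  and \<open>D = m / d\<close>. With \<open>k = 1\<close>, \<open>lengths_cong_two_base\<close>
  shows that \<open>gcd t u\<close> divides all differences of lengths; the atoms \<open>A1\<close>
  and \<open>A2\<close> show that the minimum of Delta divides \<open>t\<close> and
  \<open>u\<close>.\<close>

lemma gcd_in_Delta_star:
  assumes e: "e \<in> carrier G" "ord e = c1 * c2 * t + c1 + c2"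
    and pos: "c1 > 0" "c2 > 0" "t > 0" "u > 0"
    and D: "D * d = ord e" "D * u = c1 * t"
  shows "gcd t u \<in> Delta_star G"
proof -
  define m where "m = c1 * c2 * t + c1 + c2"
  define a where "a = 1 + c1 * t"
  define h where "h = e [^] a"
  define f where "f = e [^] d"
  define G0 where "G0 = {e, h, f}"
  define L where "L x = (if x = e then 1 else if x = h then a else d)" for x
  define L' where "L' x = (if x = h then 1 else if x = e then 1 + c2 * t else d)" for x
  have ord_e: "ord e = m" using e(2) by (simp add: m_def)
  have ma: "m = c2 * a + c1" unfolding m_def a_def by (simp add: algebra_simps)
  have m0: "m > 0" unfolding m_def using pos by simp
  have "1 * a \<le> c2 * a" using pos by (intro mult_right_mono) auto
  then have am: "1 < a" "a < m" using ma pos unfolding a_def by auto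
  have Dd: "D * d = m" using D ord_e by simp
  then have D0: "D > 0" "d > 0" using m0 by (auto intro: Nat.gr0I)
  have "D * u < D * d" using D Dd am unfolding a_def by linarith
  then have d1: "1 < d" using pos D0 by simp
  have dm: "d dvd m" using Dd by (metis dvd_triv_right)
  have d_le: "d \<le> m" using dm m0 by (rule dvd_imp_le)
  \<comment> \<open>Gives \<open>a * d = d + m * u\<close>, so \<open>f\<close> has logarithm
    \<open>d\<close> to both bases.\<close>
  have ctd: "c1 * t * d = m * u"
    unfolding D(2)[symmetric] Dd[symmetric] by (simp add: mult_ac)
  have cop: "coprime a m"
  proof -
    have "coprime a c1"
      by (rule coprimeI) (metis a_def dvd_add_left_iff dvd_mult2)
    then show ?thesis unfolding ma by (simp only: coprime_iff_gcd_eq_1 gcd_add_mult)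
  qed
  have hc: "h \<in> carrier G" "f \<in> carrier G" unfolding h_def f_def using e by auto
  have ord_h: "ord h = m"
    using ord_pow_gen[OF e(1), of a] cop am ord_e unfolding h_def
    by (simp add: coprime_iff_gcd_eq_1 gcd.commute)
  have eh: "e \<noteq> h"
    using pow_inj[OF e(1), of 1 a] am ord_e e unfolding h_def by auto
  have fe: "f \<noteq> e"
    using pow_inj[OF e(1), of d 1] d1 d_le ord_e e m0 unfolding f_def by auto
  have fh: "f \<noteq> h"
  proof
    assume "f = h"
    then have "d = a" using pow_inj[OF e(1), of d a] d1 d_le ord_e am unfolding f_def h_def by auto
    then have "d dvd 1" using cop dm by (metis coprime_common_divisor dvd_refl)
    then show False using d1 by simp
  qed
  have hback: "h [^] (1 + c2 * t) = e"
  proof -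
    have eq: "a * (1 + c2 * t) = 1 + m * t" unfolding a_def m_def by (simp add: algebra_simps)
    have "h [^] (1 + c2 * t) = e [^] (1 + m * t)"
      unfolding h_def nat_pow_pow[OF e(1)] eq by simp
    also have "\<dots> = e [^] (1::nat)" by (intro pow_mod_ord[OF e(1)]) (simp only: cong_def ord_e mod_mult_self2)
    finally show ?thesis using e(1) by simp
  qed
  have hf: "h [^] d = f"
  proof -
    have eq: "a * d = d + m * u" unfolding a_def using ctd by (simp add: algebra_simps)
    have "h [^] d = e [^] (d + m * u)"
      unfolding h_def nat_pow_pow[OF e(1)] eq by simp
    also have "\<dots> = e [^] d" by (intro pow_mod_ord[OF e(1)]) (simp only: cong_def ord_e mod_mult_self2)
    finally show ?thesis unfolding f_def .
  qed
  have Lvals: "L e = 1" "L h = a" "L f = d" "L' h = 1" "L' e = 1 + c2 * t" "L' f = d"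
    unfolding L_def L'_def using eh fe fh by simp_all
  have pows: "e [^] L e = e" "e [^] L h = h" "e [^] L f = f"
    "h [^] L' e = e" "h [^] L' h = h" "h [^] L' f = f"
    unfolding Lvals using e(1) hc(1) hback hf by (simp_all add: h_def f_def)
  interpret E: log_base G G0 e L
  proof
    show "e [^] L x = x" if "x \<in> G0" for x using that pows(1-3) unfolding G0_def by blast
  qed (use e(1) ord_e m0 in simp_all)
  interpret H: log_base G G0 h L'
  proof
    show "h [^] L' x = x" if "x \<in> G0" for x using that pows(4-6) unfolding G0_def by blast
  qed (use hc(1) ord_h m0 in simp_all)
  have rest: "x = f" if "x \<in> G0 - {e, h}" for x using that unfolding G0_def by blast
  interpret two_base G G0 e L h L' m c1 c2 t
  proof
    show "L' x = L x \<and> 0 < L x \<and> L x dvd m" if "x \<in> G0 - {e, h}" for x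
      unfolding rest[OF that] Lvals using D0 dm by simp
    show "L x dvd L y" if "x \<in> G0 - {e, h}" "y \<in> G0 - {e, h}" for x y
      unfolding rest[OF that(1)] rest[OF that(2)] by simp
    show "e \<in> G0" "h \<in> G0" unfolding G0_def by simp_all
  qed (fact m_def ord_e ord_h pos eh Lvals Lvals[unfolded a_def])+
  define g where "g = gcd t u"
  have g0: "g > 0" unfolding g_def using pos by simp
  have cong: "[l = l'] (mod g)" if "l \<in> lengths G G0 B" "l' \<in> lengths G G0 B" for l l' B
  proof -
    have "m * g dvd 1 * (c1 * t * L x)" if "x \<in> G0 - {e, h}" for x
    proof -
      have "L x = d" using that unfolding G0_def L_def by auto
      then have "1 * (c1 * t * L x) = m * u" using ctd by simp
      then show ?thesis unfolding g_def by simp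
    qed
    then have "[1 * l = 1 * l'] (mod g)"
      using that by (intro lengths_cong_two_base) (auto simp: g_def)
    then show ?thesis by simp
  qed
  have L_le: "0 < L x \<and> L x \<le> ord e" if "x \<in> G0" for x
    unfolding L_def using am D0 d_le ord_e by auto
  \<comment> \<open>Both atoms have index \<open>1\<close> to base \<open>h\<close>; to base
    \<open>e\<close> their indices are \<open>1 + t\<close> and \<open>1 + (D - 1) * u\<close>. By
    \<open>atom_lengths\<close> they realize the differences \<open>t\<close> and
    \<open>(D - 1) * u\<close>.\<close>
  define A1 where "A1 = replicate_mset (c1 - 1) e + replicate_mset (1 + c2 * (1 + t)) h"
  define A2 where "A2 = add_mset f (replicate_mset (m - d) h)"
  obtain c1' where c1': "c1 = Suc c1'" using pos by (cases c1) auto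
  obtain D' where D': "D = Suc D'" using D0 by (cases D) auto
  have A1: "A1 \<in> minimal_zero_sum_seqs G G0"
  proof (rule H.atomI)
    show "set_mset A1 \<subseteq> G0" unfolding A1_def G0_def by (auto split: if_splits)
    show "wt L' A1 = ord h" unfolding A1_def ord_h m_def using eh c1'
      by (simp add: L'_def algebra_simps)
  qed (use D0 in \<open>auto simp: L'_def\<close>)
  have A1': "wt L A1 = (1 + t) * ord e"
    unfolding A1_def ord_e m_def using eh c1' by (simp add: L_def a_def algebra_simps)
  have A2: "A2 \<in> minimal_zero_sum_seqs G G0"
  proof (rule H.atomI)
    show "set_mset A2 \<subseteq> G0" unfolding A2_def G0_def by (auto split: if_splits)
    show "wt L' A2 = ord h" unfolding A2_def ord_h using fe fh d_le
      by (simp add: L'_def)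
  qed (use D0 in \<open>auto simp: L'_def\<close>)
  have A2': "wt L A2 = (1 + D' * u) * ord e"
  proof -
    have md: "m - d = D' * d" "m = d + D' * d" using Dd D' by auto
    have "c1 * t = u + D' * u" using D D' by simp
    then have "a = 1 + u + D' * u" unfolding a_def by simp
    then have "d + D' * d * a = (1 + D' * u) * m" unfolding md(2) by (simp add: algebra_simps)
    then show ?thesis unfolding A2_def ord_e md(1) using fe fh eh by (simp add: L_def)
  qed
  obtain B1 where B1: "1 + size A1 \<in> lengths G G0 B1" "size A1 + (1 + t) \<in> lengths G G0 B1"
    using E.atom_lengths[OF mem(1) _ L_le A1 A1'] L by auto
  obtain B2 where B2: "1 + size A2 \<in> lengths G G0 B2" "size A2 + (1 + D' * u) \<in> lengths G G0 B2"
    using E.atom_lengths[OF mem(1) _ L_le A2 A2'] L by auto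
  have ne: "Delta G G0 \<noteq> {}"
    using distances_le[OF B1] pos E.lengths_zero_sum[OF B1(1)] unfolding Delta_def by fastforce
  define v where "v = (LEAST d. d \<in> Delta G G0)"
  have "v dvd t"
  proof -
    have "[1 + size A1 + t = 1 + size A1 + 0] (mod v)"
      using E.least_Delta_dvd[OF ne B1(2,1)] unfolding v_def by (simp add: add_ac)
    then show ?thesis unfolding cong_add_lcancel_nat by (simp add: cong_0_iff)
  qed
  have "v dvd D' * u"
  proof -
    have "[1 + size A2 + D' * u = 1 + size A2 + 0] (mod v)"
      using E.least_Delta_dvd[OF ne B2(2,1)] unfolding v_def by (simp add: add_ac)
    then show ?thesis unfolding cong_add_lcancel_nat by (simp add: cong_0_iff)
  qed
  have "v dvd u"
  proof -
    have "v dvd c1 * t" using \<open>v dvd t\<close> by simp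
    then have "v dvd u + D' * u" using D D' by simp
    then show ?thesis using \<open>v dvd D' * u\<close> by (simp add: dvd_add_left_iff)
  qed
  with \<open>v dvd t\<close> have "v dvd g" unfolding g_def by simp
  moreover have "g dvd v"
  proof -
    obtain B l where "l \<in> lengths G G0 B" "l + v \<in> lengths G G0 B"
      using E.least_Delta_pos(1)[OF ne] unfolding v_def by blast
    then have "[l + v = l + 0] (mod g)" using cong by simp
    then show ?thesis unfolding cong_add_lcancel_nat by (simp add: cong_0_iff)
  qed
  ultimately have "v = g" by (rule dvd_antisym)
  moreover have "G0 \<subseteq> carrier G" unfolding G0_def using e hc by auto
  ultimately show ?thesis unfolding Delta_star_def g_def[symmetric] using ne unfolding v_def by blast
qed

end

text \<open>Clearing denominators, the first fraction \<open>t\<close> says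
  \<open>m = c1 * c2 * t + c1 + c2\<close>, and the second fraction \<open>u\<close> says
  \<open>D * u = c1 * t\<close> for \<open>D = m / d\<close>.\<close>

lemma I_set_subset_Delta_star:
  fixes G :: "('a, 'b) monoid_scheme" (structure)
  assumes "group G" "cyclic_group G" "finite (carrier G)" and m: "m dvd order G" and v: "v \<in> I_set m"
  shows "v \<in> Delta_star G"
proof -
  interpret comm_group G using group.cyclic_imp_abelian_group assms by blast
  obtain t u c1 c2 d where M: "(c1, c2, d) \<in> M_set m" and t: "of_nat t = frac1 m c1 c2"
    and u: "of_nat u = frac2 m c1 c2 d" and v: "v = gcd t u"
    using v unfolding I_set_def by blast
  have c: "c1 > 0" "c2 > 0" "d > 0" "d dvd m" and nz: "frac1 m c1 c2 \<noteq> 0" "frac2 m c1 c2 d \<noteq> 0"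
    and m0: "m > 0"
    using M unfolding M_set_def by auto
  have tu: "t > 0" "u > 0" using t u nz by (metis gr0I of_nat_0)+
  obtain D where D: "m = d * D" using c by blast
  have D0: "D > 0" using m0 D by (auto intro: Nat.gr0I)
  have "of_nat m - of_nat c1 - of_nat c2 = (of_nat t * (of_nat c1 * of_nat c2) :: rat)"
    using t c unfolding frac1_def by (simp add: field_simps)
  then have "(of_nat m :: rat) = of_nat (c1 * c2 * t + c1 + c2)" by (simp add: algebra_simps)
  then have mt: "m = c1 * c2 * t + c1 + c2" using of_nat_eq_iff by blast
  have "(of_nat u :: rat) * (of_nat c2 * of_nat m) = (of_nat m - of_nat c1 - of_nat c2) * of_nat d"
    using u c m0 unfolding frac2_def by (simp add: field_simps)
  also have "(of_nat m :: rat) - of_nat c1 - of_nat c2 = of_nat (c1 * c2 * t)"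
    by (subst mt) simp
  finally have "(of_nat (u * (c2 * m)) :: rat) = of_nat (c1 * c2 * t * d)" by simp
  then have "u * (c2 * m) = c1 * c2 * t * d" using of_nat_eq_iff by blast
  then have "(c2 * d) * (D * u) = (c2 * d) * (c1 * t)" unfolding D by (simp add: algebra_simps)
  then have Du: "D * u = c1 * t" using c by simp
  obtain z where z: "z \<in> carrier G" "ord z = order G"
    using ex_generator assms(2) by blast
  have oG: "order G > 0" using assms(3) by (simp add: order_gt_0_iff_finite)
  obtain k where k: "order G = m * k" using m by blast
  have k0: "k > 0" using k oG by (auto intro: Nat.gr0I)
  have "ord (z [^] k) = m"
    using ord_pow_gen[OF z(1), of k] z k k0 m0 by simp
  then show ?thesis unfolding v
    using gcd_in_Delta_star[of "z [^] k" c1 c2 t u D d] z c tu mt Du D by (simp add: mult.commute)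
qed

subsection \<open>Sets all of whose pairs are half-factorial\<close>

text \<open>Prime by prime, this is the distributivity of minimum over maximum.\<close>

lemma gcd_lcm_dvd:
  fixes a b c :: int
  assumes "a \<noteq> 0" "b \<noteq> 0" "c \<noteq> 0"
  shows "gcd (lcm a b) c dvd lcm (gcd a c) (gcd b c)"
proof (rule multiplicity_le_imp_dvd)
  fix p :: int assume "prime p"
  then show "multiplicity p (gcd (lcm a b) c) \<le> multiplicity p (lcm (gcd a c) (gcd b c))"
    using assms by (simp add: multiplicity_gcd multiplicity_lcm lcm_eq_0_iff)
qed (use assms in \<open>simp add: lcm_eq_0_iff\<close>)

lemma binary_chinese_remainder_gcd:
  fixes a b x y :: int
  assumes "[x = y] (mod gcd a b)"
  shows "\<exists>z. [z = x] (mod a) \<and> [z = y] (mod b)"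
proof -
  obtain k where k: "y = x + gcd a b * k" using assms cong_iff_lin by blast
  obtain u v where uv: "u * a + v * b = gcd a b" using bezout_int by blast
  have "[x + a * (u * k) = x] (mod a)" by (simp add: cong_iff_dvd_diff)
  moreover have "x + a * (u * k) = y - b * (v * k)"
    unfolding k uv[symmetric] by (simp add: algebra_simps)
  then have "[x + a * (u * k) = y] (mod b)" by (simp add: cong_iff_dvd_diff)
  ultimately show ?thesis by blast
qed

lemma chinese_remainder_gcd:
  fixes m y :: "'i \<Rightarrow> int"
  assumes "finite I" "\<And>i. i \<in> I \<Longrightarrow> m i \<noteq> 0"
    and "\<And>i j. i \<in> I \<Longrightarrow> j \<in> I \<Longrightarrow> [y i = y j] (mod gcd (m i) (m j))"
  shows "\<exists>z. \<forall>i\<in>I. [z = y i] (mod m i)"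
proof -
  \<comment> \<open>The last conjunct makes \<open>M\<close> act as the least common multiple: it
    turns compatibility of the new residue with each \<open>y i\<close> into compatibility with
    \<open>z\<close> modulo \<open>gcd M (m j)\<close>.\<close>
  have "\<exists>M z. M \<noteq> 0 \<and> (\<forall>i\<in>I. m i dvd M \<and> [z = y i] (mod m i)) \<and>
      (\<forall>c t. c \<noteq> 0 \<longrightarrow> (\<forall>i\<in>I. gcd (m i) c dvd t) \<longrightarrow> gcd M c dvd t)"
    using assms
  proof (induction I rule: finite_induct)
    case empty
    then show ?case by (intro exI[of _ 1]) auto
  next
    case (insert j I)
    then obtain M z where M: "M \<noteq> 0" "\<And>i. i \<in> I \<Longrightarrow> m i dvd M" "\<And>i. i \<in> I \<Longrightarrow> [z = y i] (mod m i)"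
      "\<And>c t. c \<noteq> 0 \<Longrightarrow> (\<And>i. i \<in> I \<Longrightarrow> gcd (m i) c dvd t) \<Longrightarrow> gcd M c dvd t"
      by (smt (verit, best) insert_iff)
    have mj: "m j \<noteq> 0" using insert.prems by simp
    have "gcd (m i) (m j) dvd z - y j" if "i \<in> I" for i
    proof -
      have "[z = y i] (mod gcd (m i) (m j))" using M(3)[OF that] cong_dvd_modulus by blast
      also have "[y i = y j] (mod gcd (m i) (m j))" using insert.prems that by auto
      finally show ?thesis by (simp add: cong_iff_dvd_diff)
    qed
    then have "[z = y j] (mod gcd M (m j))" using M(4)[OF mj] by (simp add: cong_iff_dvd_diff)
    then obtain z' where z': "[z' = z] (mod M)" "[z' = y j] (mod m j)"
      using binary_chinese_remainder_gcd by blast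
    have "lcm M (m j) \<noteq> 0 \<and>
        (\<forall>i\<in>insert j I. m i dvd lcm M (m j) \<and> [z' = y i] (mod m i)) \<and>
        (\<forall>c t. c \<noteq> 0 \<longrightarrow> (\<forall>i\<in>insert j I. gcd (m i) c dvd t) \<longrightarrow> gcd (lcm M (m j)) c dvd t)"
    proof (intro conjI allI impI ballI)
      show "lcm M (m j) \<noteq> 0" using M(1) mj by (simp add: lcm_eq_0_iff)
      show "m i dvd lcm M (m j)" if "i \<in> insert j I" for i using that M(2) by auto
      show "[z' = y i] (mod m i)" if "i \<in> insert j I" for i
        using that z' M(2,3)[of i] cong_dvd_modulus[of z' z M "m i"] cong_trans by blast
      show "gcd (lcm M (m j)) c dvd t" if "c \<noteq> 0" "\<forall>i\<in>insert j I. gcd (m i) c dvd t" for c t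
        using dvd_trans[OF gcd_lcm_dvd[OF M(1) mj that(1)]] M(4)[OF that(1), of t] that(2) by auto
    qed
    then show ?case by blast
  qed
  then show ?thesis by blast
qed

section \<open>Orders, directions and sums of inverse orders\<close>

context log_base
begin

text \<open>
  So \<open>x\<close> is \<open>e\<close> to the power \<open>step x \<cdot> direction x\<close>, its order is \<open>period x\<close>, and the set of two elements is
  half-factorial iff their directions agree modulo the greatest common divisor of their periods.
\<close>
definition step :: "'a \<Rightarrow> nat" where "step x = gcd (ord e) (L x)"
definition period :: "'a \<Rightarrow> nat" where "period x = ord e div step x"
definition direction :: "'a \<Rightarrow> nat" where "direction x = L x div step x"

lemma step_pos: "step x > 0" unfolding step_def using base_ord by simp

lemma step_period: "step x * period x = ord e" and step_direction: "step x * direction x = L x"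
  unfolding step_def period_def direction_def by simp_all

lemma period_pos: "period x > 0"
  using step_period[of x] base_ord by (metis gr0I mult_0_right less_irrefl)

lemma coprime_direction: "coprime (direction x) (period x)"
  unfolding step_def period_def direction_def using base_ord
  by (metis coprime_commute div_gcd_coprime less_irrefl)

lemma dvd_pow_iff: "ord e dvd k * L x \<longleftrightarrow> period x dvd k"
proof -
  have "ord e dvd k * L x \<longleftrightarrow> step x * period x dvd step x * (k * direction x)"
    by (simp add: step_period step_direction mult.left_commute)
  also have "\<dots> \<longleftrightarrow> period x dvd k"
    using step_pos[of x] coprime_direction[of x]
    by (simp add: coprime_commute coprime_dvd_mult_left_iff)
  finally show ?thesis .
qed

lemma pow_period_atom:
  assumes "x \<in> G0"
  shows "replicate_mset (period x) x \<in> minimal_zero_sum_seqs G G0"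
  unfolding atom_iff
proof (intro conjI allI impI)
  fix T assume T: "T \<subseteq># replicate_mset (period x) x \<and> T \<noteq> {#} \<and> ord e dvd wt L T"
  then obtain k where k: "T = replicate_mset k x" "k \<le> period x"
    by (metis msubseteq_replicate_msetE)
  then have "period x dvd k" "k \<noteq> 0" using T by (auto simp: dvd_pow_iff)
  then have "k = period x" using k by (simp add: dvd_imp_le le_antisym)
  then show "T = replicate_mset (period x) x" using k by simp
qed (use assms period_pos[of x] in \<open>auto simp: dvd_pow_iff split: if_splits\<close>)

lemma direction_inj:
  assumes "x \<in> G0" "y \<in> G0" "period x = period y" "[direction x = direction y] (mod period x)"
  shows "x = y"
proof -
  have "step x = step y"
    using step_period[of x] step_period[of y] assms(3) period_pos[of y] by (metis mult_cancel2 less_irrefl)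
  moreover have "[step x * direction x = step x * direction y] (mod (step x * period x))"
    using assms(4) by (rule cong_cmult_leftI)
  moreover have "step x * direction y = L y" using \<open>step x = step y\<close> by (simp add: step_direction)
  ultimately have "[L x = L y] (mod ord e)"
    by (metis step_direction step_period)
  then show ?thesis using log assms base_closed pow_mod_ord by metis
qed

text \<open>The inverses of the directions modulo the periods are compatible too, so one
  \<open>y\<close> satisfies \<open>L x * y = step x\<close> modulo \<open>ord e\<close> for all
  \<open>x\<close>; multiply \<open>wt L S\<close> by it. As \<open>step x / ord e\<close> is
  \<open>1 / period x\<close>, the claim is that the sum of the inverse orders is an
  integer.\<close>

lemma step_sum_of_compatible:
  assumes fin: "finite G0"
    and compat: "\<And>x y. x \<in> G0 \<Longrightarrow> y \<in> G0 \<Longrightarrow>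
      [direction x = direction y] (mod gcd (period x) (period y))"
    and S: "set_mset S \<subseteq> G0" "ord e dvd wt L S"
  shows "ord e dvd wt step S"
proof -
  have "\<exists>Y. [int (direction x) * Y = 1] (mod int (period x))" for x
    using coprime_direction[of x] cong_solve_coprime_int by simp
  then obtain Y where Y: "\<And>x. [int (direction x) * Y x = 1] (mod int (period x))" by metis
  have "[Y x = Y y] (mod gcd (int (period x)) (int (period y)))" if "x \<in> G0" "y \<in> G0" for x y
  proof -
    define c where "c = gcd (int (period x)) (int (period y))"
    have 1: "[int (direction x) * Y x = 1] (mod c)" "[int (direction y) * Y y = 1] (mod c)"
      using Y cong_dvd_modulus unfolding c_def by blast+
    have 2: "[int (direction x) = int (direction y)] (mod c)"
      using compat[OF that] unfolding c_def by (simp flip: cong_int_iff)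
    have "[Y x * (int (direction y) * Y y) = Y x * 1] (mod c)"
      using 1 by (intro cong_mult) auto
    moreover have "[Y x * (int (direction y) * Y y) = Y x * (int (direction x) * Y y)] (mod c)"
      using 2 by (intro cong_mult) (auto simp: cong_sym)
    moreover have "Y x * (int (direction x) * Y y) = (int (direction x) * Y x) * Y y" by simp
    moreover have "[(int (direction x) * Y x) * Y y = 1 * Y y] (mod c)"
      using 1 by (intro cong_mult) auto
    ultimately have "[Y x = Y y] (mod c)"
      by (metis cong_sym cong_trans mult_1 mult.right_neutral)
    then show ?thesis unfolding c_def .
  qed
  then obtain y where y: "\<And>x. x \<in> G0 \<Longrightarrow> [y = Y x] (mod int (period x))"
    using chinese_remainder_gcd[OF fin, of "\<lambda>x. int (period x)" Y] period_pos
    by (metis of_nat_0_eq_iff less_irrefl)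
  have *: "[int (L x) * y = int (step x)] (mod int (ord e))" if "x \<in> G0" for x
  proof -
    have "[int (direction x) * y = int (direction x) * Y x] (mod int (period x))"
      using y[OF that] by (intro cong_mult) auto
    then have "[int (direction x) * y = 1] (mod int (period x))" using Y cong_trans by blast
    then have "[int (step x) * (int (direction x) * y) = int (step x) * 1]
        (mod (int (step x) * int (period x)))" by (rule cong_cmult_leftI)
    then show ?thesis by (simp flip: mult.assoc of_nat_mult add: step_direction step_period)
  qed
  have "[int (wt L S) * y = int (wt step S)] (mod int (ord e))"
    using S(1)
  proof (induction S)
    case (add x S)
    have "[int (L x) * y + int (wt L S) * y = int (step x) + int (wt step S)] (mod int (ord e))"
      using add * by (intro cong_add) auto
    then show ?case by (simp add: distrib_right)
  qed auto
  moreover have "int (ord e) dvd int (wt L S) * y" using S(2) by simp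
  ultimately show ?thesis using cong_dvd_iff cong_sym
    by (metis cong_0_iff cong_trans int_dvd_int_iff)
qed

text \<open>If the sum of the inverse orders were \<open>1\<close> on every atom, it would determine
  all lengths. An atom of larger sum yields a difference of lengths below the size of its support;
  compatible elements of equal order coincide, so that size is at most the number of
  divisors.\<close>

lemma least_Delta_le_card_divisors:
  assumes fin: "finite G0" and ne: "Delta G G0 \<noteq> {}"
    and compat: "\<And>x y. x \<in> G0 \<Longrightarrow> y \<in> G0 \<Longrightarrow>
      [direction x = direction y] (mod gcd (period x) (period y))"
  shows "(LEAST d. d \<in> Delta G G0) \<le> card {d. d dvd ord e}"
proof -
  define v where "v = (LEAST d. d \<in> Delta G G0)"
  obtain B l where l: "l \<in> lengths G G0 B" "l + v \<in> lengths G G0 B" and v: "v > 0"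
    using least_Delta_pos[OF ne] unfolding v_def by blast
  have dvd: "ord e dvd wt step A" if "A \<in> minimal_zero_sum_seqs G G0" for A
    using that step_sum_of_compatible[OF fin compat] by (simp add: atom_iff)
  have pos: "wt step A > 0" if "A \<noteq> {#}" for A
    using that step_pos wt_eq_0_iff by (metis gr0I less_irrefl multiset_nonemptyE)
  have ge: "ord e * size F \<le> wt step (\<Sum>\<^sub># F)" if "set_mset F \<subseteq> minimal_zero_sum_seqs G G0" for F
    using that
  proof (induction F)
    case (add A F)
    then have "ord e \<le> wt step A" using dvd pos by (intro dvd_imp_le) (auto simp: atom_iff)
    then show ?case using add by simp
  qed auto
  have "\<exists>A. A \<in> minimal_zero_sum_seqs G G0 \<and> wt step A \<noteq> ord e"
  proof (rule ccontr)
    assume "\<not> ?thesis"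
    then have eq: "wt step A = ord e" if "A \<in> minimal_zero_sum_seqs G G0" for A using that by blast
    have "wt step (\<Sum>\<^sub># F) = ord e * size F" if "set_mset F \<subseteq> minimal_zero_sum_seqs G G0" for F
      using that by (induction F) (auto simp: eq)
    then have "wt step B = ord e * k" if "k \<in> lengths G G0 B" for k
      using that unfolding lengths_def by auto
    from this[OF l(1)] this[OF l(2)] show False using v base_ord by simp
  qed
  then obtain A where A: "A \<in> minimal_zero_sum_seqs G G0" "wt step A \<noteq> ord e" by blast
  have subA: "set_mset A \<subseteq> G0" using A(1) by (simp add: atom_iff)
  have "2 * ord e \<le> wt step A"
  proof -
    obtain k where k: "wt step A = ord e * k" using dvd[OF A(1)] by blast
    moreover have "wt step A > 0" using A pos by (auto simp: atom_iff)
    ultimately have "k \<noteq> 0" "k \<noteq> 1" using A(2) by auto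
    then show ?thesis unfolding k by (simp add: mult.commute)
  qed
  \<comment> \<open>the sequence \<open>C\<close> below has one factorization into the powers and a shorter one containing \<open>A\<close>\<close>
  define I where "I = set_mset A"
  have count: "count A x \<le> period x" for x
  proof (rule ccontr)
    assume *: "\<not> count A x \<le> period x"
    then have sub: "replicate_mset (period x) x \<subseteq># A" by (intro mset_subset_eqI) auto
    have "replicate_mset (period x) x = A"
      using atom_eqI[OF A(1) sub] period_pos[of x] by (auto simp: dvd_pow_iff)
    then show False using * by (metis count_replicate_mset le_refl)
  qed
  define C where "C = (\<Sum>x\<in>I. replicate_mset (period x) x)"
  have countC: "count C x = (if x \<in> I then period x else 0)" for x
    unfolding C_def count_sum I_def by simp
  have AC: "A \<subseteq># C"
    using count by (intro mset_subset_eqI) (auto simp: countC I_def not_in_iff)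
  have "C \<in> zero_sum_seqs G G0 \<and> card I \<in> lengths G G0 C"
  proof -
    define F where "F = image_mset (\<lambda>x. replicate_mset (period x) x) (mset_set I)"
    have "set_mset F \<subseteq> minimal_zero_sum_seqs G G0"
      unfolding F_def I_def using pow_period_atom subA by auto
    moreover have "\<Sum>\<^sub># F = C" unfolding F_def C_def I_def by (simp add: sum_unfold_sum_mset)
    moreover have "size F = card I" unfolding F_def I_def by simp
    ultimately have "card I \<in> lengths G G0 C" unfolding lengths_def by (intro CollectI exI[of _ F]) auto
    then show ?thesis using lengths_zero_sum by blast
  qed
  then have C: "C \<in> zero_sum_seqs G G0" "card I \<in> lengths G G0 C" by blast+
  have wtC: "wt step C = ord e * card I"
    unfolding C_def I_def by (simp add: wt_sum mult.commute[of "period _"] step_period)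
  have "C - A \<in> zero_sum_seqs G G0"
    using C(1) A(1) wt_diff[OF AC, of L] unfolding zero_sum_iff atom_iff
    by (metis dvd_add_left_iff in_diffD subset_iff)
  then obtain k where k: "k \<in> lengths G G0 (C - A)" using lengths_nonempty by blast
  then obtain F where "set_mset F \<subseteq> minimal_zero_sum_seqs G G0" "\<Sum>\<^sub># F = C - A" "k = size F"
    unfolding lengths_def by blast
  with ge[of F] have "ord e * k \<le> wt step (C - A)" by simp
  then have "ord e * (k + 2) \<le> ord e * card I"
    using wt_diff[OF AC, of step] \<open>2 * ord e \<le> wt step A\<close> wtC by (simp add: algebra_simps)
  then have kI: "k + 2 \<le> card I" using base_ord by (simp only: mult_le_cancel1)
  have "1 + k \<in> lengths G G0 (A + (C - A))" using lengths_add[OF lengths_atom[OF A(1)] k] by simp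
  then have "1 + k \<in> lengths G G0 C" using AC by simp
  then have "[card I = 1 + k] (mod v)"
    using least_Delta_dvd[OF ne C(2)] unfolding v_def by blast
  then have "v dvd card I - (1 + k)" using kI by (subst (asm) cong_altdef_nat) auto
  then have "v \<le> card I - (1 + k)" using kI by (intro dvd_imp_le) auto
  then have "v \<le> card I" by simp
  also have "card I \<le> card {d. d dvd ord e}"
  proof (rule card_inj_on_le[of period])
    show "inj_on period I"
      using direction_inj compat subA unfolding I_def inj_on_def by (metis gcd_idem_nat subsetD)
    show "period ` I \<subseteq> {d. d dvd ord e}" using step_period by (auto, metis dvd_triv_right)
    show "finite {d. d dvd ord e}" using base_ord by simp
  qed
  finally show ?thesis unfolding v_def .
qed

end

text \<open>A divisor is at most \<open>n div k\<close> or has a cofactor at most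
  \<open>k\<close>.\<close>

lemma card_divisors_le:
  fixes n k :: nat
  assumes "n > 0" "k > 0"
  shows "card {d. d dvd n} \<le> n div k + k"
proof -
  have "{d. d dvd n} \<subseteq> {1..n div k} \<union> (\<lambda>j. n div j) ` {1..k}"
  proof
    fix d assume "d \<in> {d. d dvd n}"
    then obtain j where j: "n = d * j" by blast
    then have pos: "d > 0" "j > 0" using assms by (auto intro: Nat.gr0I)
    show "d \<in> {1..n div k} \<union> (\<lambda>j. n div j) ` {1..k}"
    proof (cases "j \<le> k")
      case True
      then have "d = n div j" "j \<in> {1..k}" using j pos by auto
      then show ?thesis by blast
    next
      case False
      then have "d * k \<le> n" unfolding j by simp
      then have "d \<le> n div k" using assms by (simp add: less_eq_div_iff_mult_less_eq)
      then show ?thesis using pos by simp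
    qed
  qed
  then have "card {d. d dvd n} \<le> card ({1..n div k} \<union> (\<lambda>j. n div j) ` {1..k})"
    by (intro card_mono) auto
  also have "\<dots> \<le> card {1..n div k} + card ((\<lambda>j. n div j) ` {1..k})" by (rule card_Un_le)
  also have "\<dots> \<le> n div k + k" using card_image_le[of "{1..k}" "\<lambda>j. n div j"] by simp
  finally show ?thesis .
qed

subsection \<open>Pairs that are not half-factorial\<close>

context log_base
begin

text \<open>The sequences \<open>P x y\<close> behave like sequences over \<open>{1, a}\<close> in
  the integers modulo \<open>d\<close>, and atoms among them have index \<open>1\<close> modulo
  \<open>v\<close>. With the divisions \<open>d = q * a + r\<close> and
  \<open>a = w * r + t\<close>, two such atoms show that \<open>v\<close> divides
  \<open>a - 1\<close> and \<open>w\<close>; as \<open>v\<close> is large,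
  \<open>t = 1\<close>.\<close>

lemma incompatible_pair:
  fixes v :: nat
  assumes cong: "\<And>B l l'. l \<in> lengths G G0 B \<Longrightarrow> l' \<in> lengths G G0 B \<Longrightarrow> [l = l'] (mod v)"
    and v: "10 * v \<ge> ord e" "v \<ge> 10"
    and g: "g \<in> G0" and h: "h \<in> G0"
  defines "d \<equiv> gcd (period g) (period h)"
  assumes incompat: "\<not> [direction g = direction h] (mod d)"
  shows "\<exists>q r s. q > 0 \<and> r > 0 \<and> s > 0 \<and> d = q * (1 + r * s * v) + r \<and>
           [direction h = (1 + r * s * v) * direction g] (mod d)"
proof -
  define X where "X = direction g"
  define Y where "Y = direction h"
  have gh: "g \<noteq> h" using incompat by auto
  have d0: "d > 0" unfolding d_def using period_pos by simp
  obtain \<alpha> \<beta> where \<alpha>: "period g = \<alpha> * d" and \<beta>: "period h = \<beta> * d" and cop: "coprime \<alpha> \<beta>"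
  proof -
    have "gcd (period g) (period h) \<noteq> 0" using d0 unfolding d_def by simp
    then show ?thesis using gcd_coprime_exists that unfolding d_def by blast
  qed
  have \<alpha>\<beta>0: "\<alpha> > 0" "\<beta> > 0" using \<alpha> \<beta> period_pos[of g] period_pos[of h] by (auto intro: Nat.gr0I)
  have "\<alpha> * d dvd ord e" "\<beta> * d dvd ord e"
    using step_period[of g] step_period[of h] \<alpha> \<beta> by (metis dvd_triv_right)+
  obtain N where N: "ord e = \<alpha> * \<beta> * N * d"
  proof -
    have "d dvd ord e" using \<open>\<alpha> * d dvd ord e\<close> dvd_mult_right by blast
    then obtain n' where n': "ord e = n' * d" by (metis dvd_def mult.commute)
    then have "\<alpha> dvd n'" "\<beta> dvd n'"
      using \<open>\<alpha> * d dvd ord e\<close> \<open>\<beta> * d dvd ord e\<close> d0 by auto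
    then have "\<alpha> * \<beta> dvd n'" using cop by (simp add: divides_mult)
    then show ?thesis using that n' by (auto simp: dvd_def)
  qed
  have N0: "N > 0" using N base_ord by (auto intro: Nat.gr0I)
  have "step g * (\<alpha> * d) = (\<beta> * N) * (\<alpha> * d)" "step h * (\<beta> * d) = (\<alpha> * N) * (\<beta> * d)"
    using step_period[of g] step_period[of h] \<alpha> \<beta> N by (simp_all add: mult_ac)
  then have steps: "step g = \<beta> * N" "step h = \<alpha> * N" using \<alpha>\<beta>0 d0 by simp_all
  have Lg: "L g = \<beta> * N * X" and Lh: "L h = \<alpha> * N * Y"
    unfolding X_def Y_def using step_direction[of g] step_direction[of h] steps by simp_all
  have copX: "coprime X (\<alpha> * d)" "coprime Y (\<beta> * d)"
    unfolding X_def Y_def using coprime_direction[of g] coprime_direction[of h] \<alpha> \<beta> by simp_all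
  have d2: "d \<noteq> 1" using incompat by auto
  \<comment> \<open>Taking \<alpha> and \<beta> as exponents, \<open>g\<close> and \<open>h\<close>
    yield generators of the common subgroup of order \<open>d\<close>; the second is the power of
    the first with exponent \<open>a\<close>.\<close>
  obtain a where a: "[Y = a * X] (mod d)" "a < d"
  proof -
    obtain x where x: "[X * x = 1] (mod d)"
      using cong_solve_coprime_nat[of X d] copX by auto
    have "[Y * (X * x) = Y * 1] (mod d)" using x by (intro cong_mult) auto
    then have "[Y = (x * Y mod d) * X] (mod d)"
      by (simp add: cong_def mod_mult_right_eq mult_ac)
    then show ?thesis using that d0 by auto
  qed
  have copa: "coprime a d"
  proof -
    have "coprime (a * X) d" using a(1) copX(2) cong_imp_coprime
      by (metis coprime_mult_right_iff)
    then show ?thesis by simp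
  qed
  have a0: "a > 0" using copa d2 by (auto intro!: Nat.gr0I)
  have a1: "a \<noteq> 1" using a incompat unfolding X_def Y_def by (auto simp: cong_sym_eq)
  define P where "P x y = replicate_mset (\<alpha> * x) g + replicate_mset (\<beta> * y) h" for x y
  have wtP: "ord e dvd wt L (P x y) \<longleftrightarrow> d dvd x + a * y" for x y
  proof -
    have "wt L (P x y) = \<alpha> * \<beta> * N * (x * X + y * Y)"
      unfolding P_def by (simp add: Lg Lh algebra_simps)
    then have "ord e dvd wt L (P x y) \<longleftrightarrow> d dvd x * X + y * Y"
      unfolding N using \<alpha>\<beta>0 N0 by simp
    also have "\<dots> \<longleftrightarrow> d dvd x * X + y * (a * X)"
      using a(1) by (intro cong_dvd_iff cong_add cong_mult) auto
    also have "\<dots> \<longleftrightarrow> d dvd (x + a * y) * X" by (simp add: algebra_simps)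
    also have "\<dots> \<longleftrightarrow> d dvd x + a * y"
      using copX(1) by (simp add: coprime_commute coprime_dvd_mult_left_iff)
    finally show ?thesis .
  qed
  \<comment> \<open>In a zero-sum subsequence, coprimality forces \<alpha> to divide the
    multiplicity of \<open>g\<close>, and \<beta> that of \<open>h\<close>; so it is again of the
    form \<open>P x' y'\<close>.\<close>
  have subP: "\<exists>x' y'. x' \<le> x \<and> y' \<le> y \<and> T = P x' y' \<and> d dvd x' + a * y'"
    if T: "T \<subseteq># P x y" "ord e dvd wt L T" for T x y
  proof -
    have "set_mset T \<subseteq> {g, h}"
      using set_mset_mono[OF T(1)] unfolding P_def by (auto split: if_splits)
    then have Teq: "T = replicate_mset (count T g) g + replicate_mset (count T h) h"
      using gh by (intro multiset_eqI) (auto simp: count_eq_zero_iff)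
    define i j where "i = count T g" and "j = count T h"
    have "wt L T = N * (i * \<beta> * X + j * \<alpha> * Y)"
      unfolding i_def j_def by (subst Teq) (simp add: Lg Lh algebra_simps)
    moreover have "ord e = N * (\<alpha> * \<beta> * d)" unfolding N by simp
    ultimately have ij: "\<alpha> * \<beta> * d dvd i * \<beta> * X + j * \<alpha> * Y" using T(2) N0 by simp
    have "\<alpha> dvd i * \<beta> * X + j * \<alpha> * Y" "\<beta> dvd i * \<beta> * X + j * \<alpha> * Y"
      using ij dvd_mult_left dvd_mult_right by (metis mult.assoc mult.commute)+
    then have "\<alpha> dvd i * \<beta> * X" "\<beta> dvd j * \<alpha> * Y"
      by (simp_all add: dvd_add_left_iff dvd_add_right_iff)
    moreover have "coprime \<alpha> X" "coprime \<beta> Y" using copX by (simp_all add: coprime_commute)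
    ultimately have "\<alpha> dvd i" "\<beta> dvd j"
      using cop by (simp_all add: coprime_dvd_mult_left_iff coprime_commute)
    then obtain x' y' where xy: "i = \<alpha> * x'" "j = \<beta> * y'" by blast
    have TP: "T = P x' y'" unfolding P_def xy[symmetric] i_def j_def by (rule Teq)
    have "i \<le> \<alpha> * x" "j \<le> \<beta> * y"
      using mset_subset_eq_count[OF T(1), of g] mset_subset_eq_count[OF T(1), of h] gh
      unfolding i_def j_def P_def by auto
    then have "x' \<le> x" "y' \<le> y" using xy \<alpha>\<beta>0 by auto
    moreover have "d dvd x' + a * y'" using T(2) unfolding TP wtP .
    ultimately show ?thesis using TP by blast
  qed
  \<comment> \<open>Minimality of the value \<open>x + a * y\<close> suffices: since
    \<open>a > 0\<close>, a smaller pair of the same value is the same pair.\<close>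
  have atomP: "P x y \<in> minimal_zero_sum_seqs G G0"
    if "0 < x + a * y" "d dvd x + a * y"
      and "\<And>x' y'. x' \<le> x \<Longrightarrow> y' \<le> y \<Longrightarrow> d dvd x' + a * y' \<Longrightarrow> 0 < x' + a * y' \<Longrightarrow>
        x + a * y \<le> x' + a * y'" for x y
    unfolding atom_iff
  proof (intro conjI allI impI)
    show "set_mset (P x y) \<subseteq> G0" unfolding P_def using g h by (auto split: if_splits)
    show "P x y \<noteq> {#}"
      using that(1) \<alpha>\<beta>0 unfolding P_def by (cases "x = 0"; cases "y = 0") simp_all
    show "ord e dvd wt L (P x y)" using that(2) wtP by simp
    fix T assume T: "T \<subseteq># P x y \<and> T \<noteq> {#} \<and> ord e dvd wt L T"
    then obtain x' y' where xy: "x' \<le> x" "y' \<le> y" "T = P x' y'" "d dvd x' + a * y'"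
      using subP[of T x y] by metis
    have "x' \<noteq> 0 \<or> y' \<noteq> 0" using T unfolding xy(3) P_def by (cases "x' = 0"; cases "y' = 0") simp_all
    then have "0 < x' + a * y'" using a0 by auto
    with xy have *: "x + a * y \<le> x' + a * y'" by (intro that(3))
    have "a * y' \<le> a * y" using xy by simp
    with * xy(1) have "x = x'" "a * y = a * y'" by linarith+
    then show "T = P x y" using xy(3) a0 by simp
  qed
  have atom_d: "P x y \<in> minimal_zero_sum_seqs G G0" if "x + a * y = d" for x y
  proof (rule atomP)
    show "x + a * y \<le> x' + a * y'" if "d dvd x' + a * y'" "0 < x' + a * y'" for x' y'
      using that dvd_imp_le \<open>x + a * y = d\<close> by metis
  qed (use that d0 in auto)
  have P_add: "P x y + P x' y' = P (x + x') (y + y')" for x y x' y'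
    unfolding P_def by (simp add: replicate_mset_add distrib_left)
  have P_rep: "repeat_mset k (P x y) = P (k * x) (k * y)" for k x y
    unfolding P_def by (intro multiset_eqI) simp
  define U where "U = P d 0"
  define V where "V = P (d - a) 1"
  have U: "U \<in> minimal_zero_sum_seqs G G0" unfolding U_def by (intro atom_d) simp
  have V: "V \<in> minimal_zero_sum_seqs G G0" unfolding V_def using a by (intro atom_d) simp
  \<comment> \<open>Read off from \<open>P x y U^y = V^y U^k\<close>, whose sides have lengths
    \<open>1 + y\<close> and \<open>y + k\<close>.\<close>
  have index: "[k = 1] (mod v)" if A: "P x y \<in> minimal_zero_sum_seqs G G0" "x + a * y = k * d" for x y k
  proof -
    have "x + y * d = y * (d - a) + k * d"
    proof -
      have "y * d = y * (d - a) + a * y" using a(2) by (simp add: algebra_simps flip: distrib_left)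
      then show ?thesis using A(2) by linarith
    qed
    then have "P x y + repeat_mset y U = repeat_mset y V + repeat_mset k U"
      unfolding U_def V_def P_rep P_add by simp
    moreover have "1 + y * 1 \<in> lengths G G0 (P x y + repeat_mset y U)"
      using lengths_atom[OF A(1)] lengths_atom[OF U] by (intro lengths_add lengths_repeat) auto
    moreover have "y * 1 + k * 1 \<in> lengths G G0 (repeat_mset y V + repeat_mset k U)"
      using lengths_atom[OF V] lengths_atom[OF U] by (intro lengths_add lengths_repeat) auto
    ultimately have "[y + k = y + 1] (mod v)" using cong by (metis add.commute mult.right_neutral)
    then show ?thesis by (simp only: cong_add_lcancel_nat)
  qed
  have va: "[a = 1] (mod v)"
  proof (rule index)
    show "P 0 d \<in> minimal_zero_sum_seqs G G0"
    proof (rule atomP)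
      fix x' y' assume *: "x' \<le> 0" "y' \<le> d" "d dvd x' + a * y'" "0 < x' + a * y'"
      then have "d dvd y'" using copa by (simp add: coprime_dvd_mult_right_iff coprime_commute)
      moreover have "y' > 0" using * by (auto intro: Nat.gr0I)
      ultimately have "y' = d" using * by (simp add: dvd_imp_le le_antisym)
      then show "0 + a * d \<le> x' + a * y'" by simp
    qed (use a0 d0 in auto)
  qed simp
  \<comment> \<open>The remainder \<open>t\<close> is normalized to \<open>{1..r}\<close> instead of
    \<open>{0..<r}\<close>, so that \<open>(w + 1) * r - a = r - t\<close> is nonnegative and below
    \<open>r\<close>.\<close>
  define q r w t where "q = d div a" and "r = d mod a" and "w = (a - 1) div r"
    and "t = (a - 1) mod r + 1"
  have dqr: "d = q * a + r" unfolding q_def r_def by simp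
  have r: "0 < r" "r < a"
  proof -
    show "r < a" unfolding r_def using a0 by simp
    have "\<not> a dvd d" using copa a1 by (metis coprime_common_divisor dvd_refl nat_dvd_1_iff_1)
    then show "0 < r" unfolding r_def by (simp add: mod_greater_zero_iff_not_dvd)
  qed
  have q: "0 < q" unfolding q_def using a a0 by (simp add: div_greater_zero_iff)
  have "a - 1 = w * r + (t - 1)" unfolding w_def t_def by simp
  then have awt: "a = w * r + t" using a0 unfolding t_def by simp
  have t: "1 \<le> t" "t \<le> r" unfolding t_def using r by (auto simp: Suc_le_eq)
  have w0: "0 < w" unfolding w_def using r by (simp add: div_greater_zero_iff)
  have total: "(r - t) + a * ((w + 1) * q + 1) = (w + 1) * d"
  proof -
    have "(r - t) + a = (w + 1) * r" using awt t by simp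
    then show ?thesis unfolding dqr by (simp add: algebra_simps)
  qed
  \<comment> \<open>the corner of the Newton polygon of the relation lattice that follows \<open>(r, q)\<close>\<close>
  have "[w + 1 = 1] (mod v)"
  proof (rule index[OF atomP total])
    fix x' y' assume *: "x' \<le> r - t" "d dvd x' + a * y'" "0 < x' + a * y'"
    \<comment> \<open>From \<open>a * (y' - q * i) = r * i - x' >= t > 0\<close> follows
      \<open>a <= r * i\<close>, which forces \<open>i > w\<close>.\<close>
    obtain i where i: "x' + a * y' = d * i" using * by blast
    have i0: "i > 0" using * i by (auto intro: Nat.gr0I)
    have "int a * (int y' - int q * int i) = int r * int i - int x'"
      using arg_cong[OF i, of int] unfolding dqr by (simp add: algebra_simps)
    moreover have "int r * int i - int x' \<ge> int t"
    proof -
      have "r * 1 \<le> r * i" using i0 by (intro mult_left_mono) auto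
      then have "x' + t \<le> r * i" using * t by linarith
      then show ?thesis by (metis add.commute le_diff_eq of_nat_add of_nat_le_iff of_nat_mult)
    qed
    ultimately have "0 < int a * (int y' - int q * int i)" using t by linarith
    then have "1 \<le> int y' - int q * int i" using a0 by (simp add: zero_less_mult_iff)
    then have "int a * 1 \<le> int a * (int y' - int q * int i)" by (intro mult_left_mono) auto
    then have "int a \<le> int r * int i" using \<open>int a * _ = int r * int i - int x'\<close> by linarith
    then have "a \<le> r * i" by (metis of_nat_le_iff of_nat_mult)
    then have "r * w + t \<le> r * i" using awt by (simp add: mult.commute)
    then have "r * w < r * i" using t by linarith
    then have "w + 1 \<le> i" by simp
    then have "(w + 1) * d \<le> i * d" by (rule mult_right_mono) simp
    then show "r - t + a * ((w + 1) * q + 1) \<le> x' + a * y'"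
      unfolding total using i by (simp add: mult.commute)
  qed (use a0 total d0 in \<open>auto simp del: mult_Suc mult_Suc_right\<close>)
  then have "[w + 1 = 0 + 1] (mod v)" by simp
  then have vw: "v dvd w" by (simp only: cong_add_rcancel_nat cong_0_iff)
  then obtain s where s: "w = s * v" by (metis dvd_def mult.commute)
  have s0: "s > 0" using s w0 by (auto intro: Nat.gr0I)
  \<comment> \<open>The chain yields \<open>r * v < 10 * v\<close>, hence
    \<open>r < 10 <= v\<close>; then \<open>t\<close>, which lies in \<open>{1..r}\<close>, is
    determined by its residue modulo \<open>v\<close>.\<close>
  have "r < v"
  proof -
    have "r * v \<le> r * w" using dvd_imp_le[OF vw w0] by (rule mult_left_mono) simp
    also have "r * w = w * r" by (rule mult.commute)
    also have "\<dots> < a" using awt t by linarith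
    also have "a < d" by (rule a(2))
    also have "d \<le> ord e" using N base_ord by (intro dvd_imp_le) auto
    also have "\<dots> \<le> 10 * v" by (rule v)
    finally show ?thesis using v by simp
  qed
  have "t = 1"
  proof -
    have "[w * r + t = 0 + 1] (mod v)" using va awt by simp
    moreover have "[w * r + t = 0 + t] (mod v)" using vw by (intro cong_add) (auto simp: cong_0_iff)
    ultimately have "[t = 1] (mod v)" by (metis add_0 cong_sym cong_trans)
    then show ?thesis using t \<open>r < v\<close> v(2) by (intro cong_less_modulus_unique_nat[of t 1 v]) auto
  qed
  then have aeq: "a = 1 + r * s * v" using awt s by (simp add: mult_ac)
  show ?thesis
    using q r s0 dqr a(1) unfolding aeq X_def Y_def by blast
qed

end

text \<open>
  The witness for the divisor is \<open>d = m / D\<close>, which makes the two fractions \<open>s v\<close> and \<open>k v\<close>.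
\<close>
lemma I_setI:
  assumes pos: "c1 > 0" "c2 > 0" "s > 0" "v > 0" and k: "D * k = c1 * s" "coprime s k"
    and D: "D dvd c1 + c2"
  shows "v \<in> I_set (c1 * c2 * s * v + c1 + c2)"
proof -
  define m where "m = c1 * c2 * s * v + c1 + c2"
  have m0: "m > 0" unfolding m_def using pos by simp
  have "D dvd D * k * (c2 * v)" by simp
  then have "D dvd c1 * c2 * s * v" unfolding k by (simp add: mult_ac)
  then have "D dvd m" unfolding m_def using D by (simp add: add.assoc)
  then obtain d where d: "m = D * d" by blast
  have D0: "D > 0" "d > 0" using d m0 by (auto intro: Nat.gr0I)
  have k0: "k > 0" using k pos by (metis gr0I mult_0_right mult_pos_pos less_irrefl)
  have diff: "(of_nat m :: rat) - of_nat c1 - of_nat c2 = of_nat (c1 * c2 * s * v)"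
    unfolding m_def by simp
  have 1: "frac1 m c1 c2 = of_nat (s * v)"
    unfolding frac1_def diff using pos by (simp add: field_simps)
  have 2: "frac2 m c1 c2 d = of_nat (k * v)"
  proof -
    have "c1 * c2 * s * v * d = (D * k) * (c2 * v * d)" unfolding k by (simp add: mult_ac)
    also have "\<dots> = k * v * (c2 * m)" unfolding d by (simp add: mult_ac)
    finally have *: "of_nat (c1 * c2 * s * v) * of_nat d = (of_nat (k * v) * (of_nat c2 * of_nat m) :: rat)"
      by (metis of_nat_mult)
    have "of_nat c2 * of_nat m \<noteq> (0 :: rat)" using pos m0 by simp
    then show ?thesis unfolding frac2_def diff * by (rule nonzero_mult_div_cancel_right)
  qed
  have "c1 \<le> m" "c2 \<le> m" unfolding m_def by auto
  moreover have "of_nat (s * v) \<noteq> (0::rat)" "of_nat (k * v) \<noteq> (0::rat)" using pos k0 by simp_all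
  ultimately have "(c1, c2, d) \<in> M_set m"
    unfolding M_set_def using 1 2 pos D0 d by auto
  moreover have "v = gcd (s * v) (k * v)"
    using k(2) by (simp add: gcd_mult_right coprime_iff_gcd_eq_1 flip: gcd_mult_distrib_nat
        add: mult.commute[of _ v])
  ultimately show ?thesis unfolding I_set_def m_def[symmetric] using 1 2
    by (intro CollectI exI[of _ "s * v"] exI[of _ "k * v"] exI[of _ c1] exI[of _ c2] exI[of _ d]) auto
qed

subsection \<open>The possible orders\<close>

lemma ex_I_setI:
  assumes "n = R * (c1 * c2 * s * v + c1 + c2)" "c1 > 0" "c2 > 0" "s > 0" "v > 0"
    and "D * k = c1 * s" "coprime s k" "D dvd c1 + c2"
  shows "\<exists>m. m dvd n \<and> v \<in> I_set m"
  using I_setI[of c1 c2 s v D k] assms by (metis dvd_triv_right)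

text \<open>
  The pairs with \<open>c s \<le> 9\<close> for which \<open>n = c s v + c + 1\<close> does not by itself yield \<open>v \<in> I(m)\<close> for a
  divisor \<open>m\<close> of \<open>n\<close>.
\<close>
definition exceptional :: "nat \<Rightarrow> nat \<Rightarrow> bool" where
  "exceptional c s \<longleftrightarrow> (c = 1 \<and> 3 \<le> s \<and> s \<le> 9) \<or> (c, s) \<in> {(2, 2), (2, 4), (3, 3), (4, 2)}"

text \<open>For \<open>s = 1\<close> take \<open>m = n / R\<close>, \<open>c1 = q\<close>,
  \<open>c2 = r\<close>, \<open>D = 1\<close>. Otherwise \<open>R * q * r <= 4\<close> leaves a
  short list, where factors of \<open>R\<close> and \<open>s\<close> may be moved into
  \<open>c1\<close> and \<open>c2\<close>.\<close>

lemma I_set_or_exceptional: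
  fixes R q r s v n :: nat
  assumes pos: "R > 0" "q > 0" "r > 0" "s > 0" "v > 0" and le: "R * q * r * s \<le> 9"
    and n: "n = R * (q * r * s * v + q + r)"
  shows "(\<exists>m. m dvd n \<and> v \<in> I_set m) \<or>
    (\<exists>c. exceptional c s \<and> n = c * s * v + c + 1)"
proof (cases "s = 1")
  case True
  then show ?thesis using ex_I_setI[of n R q r 1 v 1 q] pos n by simp
next
  case False
  then have s2: "2 \<le> s" using pos by simp
  have "R * q * r * 2 \<le> R * q * r * s" using s2 by (rule mult_left_mono) simp
  then have le4: "R * q * r \<le> 4" using le by linarith
  have "R \<le> R * q * r" "q \<le> R * q * r" "r \<le> R * q * r"
    using pos by (intro dvd_imp_le; simp)+
  then have "R \<le> 4" "q \<le> 4" "r \<le> 4" using le4 by linarith+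
  then have "R \<in> {1,2,3,4}" "q \<in> {1,2,3,4}" "r \<in> {1,2,3,4}" using pos by auto
  then have "(R, q, r) \<in> {(1,1,1),(2,1,1),(3,1,1),(4,1,1),(1,2,1),(1,1,2),(1,3,1),(1,1,3),
      (1,4,1),(1,1,4),(2,2,1),(2,1,2),(1,2,2)}"
    using le4 by - (elim insertE emptyE; simp)
  then consider "R = 1" "q = 1" "r = 1" | "R = 2" "q = 1" "r = 1" | "R = 3" "q = 1" "r = 1"
    | "R = 4" "q = 1" "r = 1" | "R = 1" "q * r = 2" "q + r = 3" | "R = 1" "q * r = 3" "q + r = 4"
    | "R = 1" "q * r = 4" "q + r = 5" | "R = 2" "q * r = 2" "q + r = 3" | "R = 1" "q = 2" "r = 2"
    by auto
  then show ?thesis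
  proof cases
    case 1
    then have "s = 2 \<or> exceptional 1 s" using s2 le unfolding exceptional_def by auto
    then show ?thesis
    proof
      assume "s = 2"
      then show ?thesis using ex_I_setI[of n 1 1 1 2 v 2 1] pos n 1 by simp
    next
      assume "exceptional 1 s"
      then show ?thesis using n 1 by (intro disjI2 exI[of _ 1]) simp
    qed
  next
    case 2
    then have "s = 2 \<or> s = 3 \<or> s = 4" using s2 le by auto
    \<comment> \<open>For \<open>s = 2\<close> take \<open>m = n / 2\<close>. For
      \<open>s = 3\<close> and \<open>s = 4\<close> take \<open>m = n\<close>, written as
      \<open>1 * 3 * 2 * v + 1 + 3\<close> and \<open>2 * 2 * 2 * v + 2 + 2\<close>.\<close>
    then show ?thesis
      using ex_I_setI[of n 2 1 1 2 v 2 1] ex_I_setI[of n 1 1 3 2 v 2 1] ex_I_setI[of n 1 2 2 2 v 4 1] pos n 2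
      by auto
  next
    case 3
    then have "s = 2 \<or> s = 3" using s2 le by auto
    then show ?thesis
      using ex_I_setI[of n 3 1 1 2 v 2 1] ex_I_setI[of n 1 3 3 1 v 1 3] pos n 3 by auto
  next
    case 4
    then have "s = 2" using s2 le by auto
    then show ?thesis using ex_I_setI[of n 4 1 1 2 v 2 1] pos n 4 by auto
  next
    case 5
    have nn: "n = 2 * s * v + 3" using n 5 by simp
    have "2 * s \<le> 9" using le 5 by simp
    then have "s = 3 \<or> exceptional 2 s" using s2 unfolding exceptional_def by auto
    then show ?thesis
    proof
      assume "s = 3"
      moreover have "(3::nat) dvd 1 + 2" by presburger
      ultimately show ?thesis using ex_I_setI[of n 1 1 2 3 v 3 1] pos nn by simp
    next
      assume "exceptional 2 s"
      then show ?thesis using nn by (intro disjI2 exI[of _ 2]) simp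
    qed
  next
    case 6
    have nn: "n = 3 * s * v + 4" using n 6 by simp
    have "3 * s \<le> 9" using le 6 by simp
    then have "s = 2 \<or> exceptional 3 s" using s2 unfolding exceptional_def by auto
    then show ?thesis
    proof
      assume "s = 2"
      then show ?thesis using ex_I_setI[of n 1 1 3 2 v 2 1] pos nn by simp
    next
      assume "exceptional 3 s"
      then show ?thesis using nn by (intro disjI2 exI[of _ 3]) simp
    qed
  next
    case 7
    have nn: "n = 4 * s * v + 5" using n 7 by simp
    have "4 * s \<le> 9" using le 7 by simp
    then have "exceptional 4 s" using s2 unfolding exceptional_def by auto
    then show ?thesis using nn by (intro disjI2 exI[of _ 4]) simp
  next
    case 8
    have "2 * (2 * s) \<le> 9" using le 8 by (simp add: mult.assoc)
    then have "s = 2" using s2 by linarith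
    have "n = 2 * (2 * s * v + 3)" using n 8 by (simp add: mult.assoc)
    then show ?thesis using ex_I_setI[of n 1 2 4 1 v 1 2] pos \<open>s = 2\<close> by simp
  next
    case 9
    then have "s = 2" using s2 le by auto
    then show ?thesis using ex_I_setI[of n 1 2 2 2 v 4 1] pos n 9 by simp
  qed
qed

text \<open>Both \<open>R * (q + r)\<close> and \<open>c + 1\<close> are below \<open>v\<close>, so
  reduction modulo \<open>v\<close> splits the equation into \<open>R * (q + r) = c + 1\<close> and
  \<open>R * q * r * s' = c * s\<close>.\<close>

lemma exceptional_unique:
  fixes R q r s c s' v :: nat
  assumes exc: "exceptional c s" and v: "v \<ge> 200"
    and pos: "R > 0" "q > 0" "r > 0" "s' > 0" and le: "R * q * r * s' \<le> 9"
    and eq: "R * (q * r * s' * v + q + r) = c * s * v + c + 1"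
  shows "R = 1 \<and> s' = s \<and> (q = c \<and> r = 1 \<or> q = 1 \<and> r = c)"
proof -
  have "R \<le> R * q * r * s'" "q \<le> R * q * r * s'" "r \<le> R * q * r * s'"
    using pos by (intro dvd_imp_le; simp)+
  then have b: "R \<le> 9" "q \<le> 9" "r \<le> 9" using le by linarith+
  have "R * (q + r) \<le> 9 * 18" using b by (intro mult_mono) auto
  then have small: "R * (q + r) < v" using v by simp
  have c: "c \<in> {1,2,3,4}" using exc unfolding exceptional_def by auto
  then have small': "c + 1 < v" using v by auto
  have eq': "(R * q * r * s') * v + R * (q + r) = (c * s) * v + (c + 1)"
    using eq by (simp add: algebra_simps)
  have sum: "R * (q + r) = c + 1"
    using arg_cong[OF eq', of "\<lambda>x. x mod v"] small small' by simp
  then have prod: "R * q * r * s' = c * s" using eq' v by simp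
  have "R * 2 \<le> R * (q + r)" "1 * (q + r) \<le> R * (q + r)"
    using pos by (intro mult_le_mono; simp)+
  then have "R \<le> 2" "q \<le> 4" "r \<le> 4" using sum c pos by auto
  then have "R \<in> {1,2}" "q \<in> {1,2,3,4}" "r \<in> {1,2,3,4}" using pos by auto
  \<comment> \<open>The sum also admits \<open>(2, 1, 1)\<close> and \<open>(1, 2, 2)\<close> for
    \<open>c = 3\<close>, and \<open>q\<close>, \<open>r\<close> equal to \<open>2\<close>,
    \<open>3\<close> in some order for \<open>c = 4\<close>; the products \<open>9\<close> and
    \<open>8\<close> exclude these.\<close>
  then have "R = 1 \<and> (q = c \<and> r = 1 \<or> q = 1 \<and> r = c) \<or>
      c = 3 \<and> R * q * r \<in> {2, 4} \<or> c = 4 \<and> R * q * r = 6"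
    using sum c by - (elim insertE emptyE; simp)
  then show ?thesis
  proof (elim disjE)
    assume *: "R = 1 \<and> (q = c \<and> r = 1 \<or> q = 1 \<and> r = c)"
    then have "c * s' = c * s" using prod by auto
    then show ?thesis using * c by auto
  next
    assume *: "c = 3 \<and> R * q * r \<in> {2, 4}"
    then have "s = 3" using exc unfolding exceptional_def by auto
    with * prod have "2 * s' = 9 \<or> 4 * s' = 9" by auto
    then show ?thesis by presburger
  next
    assume *: "c = 4 \<and> R * q * r = 6"
    then have "s = 2" using exc unfolding exceptional_def by auto
    with * prod have "6 * s' = 8" by auto
    then show ?thesis by presburger
  qed
qed

section \<open>Exclusion of the exceptional orders\<close>

context log_base
begin

text \<open>By \<open>exceptional_unique\<close> an incompatible pair consists of elements of full
  order \<open>n\<close> with ratio \<open>1 + w\<close> or \<open>1 + c * w\<close>. Around one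
  such pair \<open>x\<close>, \<open>y\<close> every other element is compatible with both, and
  \<open>two_base\<close> applies with \<open>c1 = 1\<close>, \<open>c2 = c\<close>,
  \<open>t = w\<close>.\<close>

lemma not_exceptional:
  assumes ne: "Delta G G0 \<noteq> {}"
  defines "v \<equiv> (LEAST d. d \<in> Delta G G0)"
  assumes v: "10 * v \<ge> ord e" "v \<ge> 200"
    and exc: "exceptional c s" and n: "ord e = c * s * v + c + 1"
    and gh: "g \<in> G0" "h \<in> G0"
    and incompat: "\<not> [direction g = direction h] (mod gcd (period g) (period h))"
  shows False
proof -
  define n w where "n = ord e" and "w = s * v"
  have nw: "n = c * w + c + 1" unfolding n_def w_def n by simp
  have c: "1 \<le> c" "c \<le> 4" and s: "s > 0" using exc unfolding exceptional_def by auto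
  have w0: "w > 0" unfolding w_def using s v by simp
  have cong: "[l = l'] (mod v)" if "l \<in> lengths G G0 B" "l' \<in> lengths G G0 B" for l l' B
    using least_Delta_dvd[OF ne that] unfolding v_def .
  have alt: "[direction x = direction y] (mod gcd (period x) (period y)) \<or>
      period x = n \<and> period y = n \<and>
      ([direction y = (1 + w) * direction x] (mod n) \<or> [direction y = (1 + c * w) * direction x] (mod n))"
    if xy: "x \<in> G0" "y \<in> G0" for x y
  proof (cases "[direction x = direction y] (mod gcd (period x) (period y))")
    case nc: False
    define d where "d = gcd (period x) (period y)"
    have "\<exists>q r s'. q > 0 \<and> r > 0 \<and> s' > 0 \<and> d = q * (1 + r * s' * v) + r \<and>
        [direction y = (1 + r * s' * v) * direction x] (mod d)"
      unfolding d_def using v by (intro incompatible_pair[OF cong _ _ xy nc]) auto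
    then obtain q r s' where qrs: "q > 0" "r > 0" "s' > 0" "d = q * (1 + r * s' * v) + r"
      "[direction y = (1 + r * s' * v) * direction x] (mod d)" by blast
    have dvds: "d dvd period x" "d dvd period y" "period x dvd n" "period y dvd n"
      unfolding d_def n_def using step_period by (auto, metis dvd_triv_right, metis dvd_triv_right)
    then obtain R where R: "n = R * d" by (metis dvd_def dvd_trans mult.commute)
    have R0: "R > 0" using R base_ord unfolding n_def by (auto intro: Nat.gr0I)
    have deq: "R * (q * r * s' * v + q + r) = c * s * v + c + 1"
      using R n unfolding n_def qrs(4) by (simp add: algebra_simps)
    have "R * q * r * s' * v < R * (q * r * s' * v + q + r)"
      using R0 qrs by (simp add: algebra_simps)
    also have "\<dots> \<le> 10 * v" using deq n v by simp
    finally have "R * q * r * s' < 10" using v by simp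
    then have "R = 1 \<and> s' = s \<and> (q = c \<and> r = 1 \<or> q = 1 \<and> r = c)"
      using exceptional_unique[OF exc v(2) R0 qrs(1-3) _ deq] by simp
    then have R1: "d = n" "r * s' * v = w \<or> r * s' * v = c * w" using R unfolding w_def by auto
    then have "period x = n" "period y = n" using dvds by (metis dvd_antisym)+
    then show ?thesis using R1 qrs(5) by metis
  qed simp
  \<comment> \<open>The two ratios are inverse modulo \<open>n\<close>, so the pair can be ordered
    to have ratio \<open>1 + w\<close>.\<close>
  have inverse_eq: "(1 + w) * (1 + c * w) = 1 + n * w" unfolding nw by (simp add: algebra_simps)
  have inv_cong: "[(1 + w) * ((1 + c * w) * k) = k] (mod n)" for k
  proof -
    have "(1 + w) * ((1 + c * w) * k) = k + n * (w * k)"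
      unfolding mult.assoc[symmetric] inverse_eq by (simp add: algebra_simps)
    then show ?thesis by (simp only: cong_def mod_mult_self2)
  qed
  obtain x y where xy: "x \<in> G0" "y \<in> G0" "period x = n" "period y = n"
    "[direction y = (1 + w) * direction x] (mod n)"
  proof -
    have "period g = n" "period h = n" and
      cases_h: "[direction h = (1 + w) * direction g] (mod n) \<or> [direction h = (1 + c * w) * direction g] (mod n)"
      using alt[OF gh] incompat by blast+
    from cases_h show ?thesis
    proof
      assume "[direction h = (1 + c * w) * direction g] (mod n)"
      then have "[(1 + w) * direction h = (1 + w) * ((1 + c * w) * direction g)] (mod n)"
        by (rule cong_scalar_left)
      then have "[direction g = (1 + w) * direction h] (mod n)"
        using inv_cong cong_trans cong_sym by blast
      then show ?thesis using that gh \<open>period g = n\<close> \<open>period h = n\<close> by blast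
    qed (use that gh \<open>period g = n\<close> \<open>period h = n\<close> in blast)
  qed
  have x_of_y: "[direction x = (1 + c * w) * direction y] (mod n)"
  proof -
    have "[(1 + c * w) * direction y = (1 + c * w) * ((1 + w) * direction x)] (mod n)"
      using xy(5) by (rule cong_scalar_left)
    moreover have "(1 + c * w) * ((1 + w) * direction x) = (1 + w) * ((1 + c * w) * direction x)"
      by (simp add: algebra_simps)
    ultimately show ?thesis using inv_cong cong_trans cong_sym by metis
  qed
  have direction_eq: "a = b" if "a \<in> G0" "b \<in> G0" "period a = n" "period b = n" "[direction a = direction b] (mod n)" for a b
    using direction_inj that by simp
  have cop: "coprime (direction x) n" using coprime_direction[of x] xy(3) by simp
  have ncop: "gcd w n dvd c + 1"
    unfolding nw by (metis add.assoc dvd_add_right_iff dvd_mult gcd_dvd1 gcd_dvd2)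
  \<comment> \<open>\<open>1 + w\<close> is not a cube root of unity modulo \<open>n\<close>, as \<open>n\<close> would divide \<open>c\<^sup>3 + 1\<close>\<close>
  have no_cube: "\<not> [(1 + w) * (1 + w) = 1 + c * w] (mod n)"
  proof
    assume "[(1 + w) * (1 + w) = 1 + c * w] (mod n)"
    then have "[int ((1 + w) * (1 + w)) = int (1 + c * w)] (mod int n)" by (simp only: cong_int_iff)
    then have "int n dvd (1 + int w)\<^sup>2 - (1 + int c * int w)"
      by (simp add: cong_iff_dvd_diff power2_eq_square algebra_simps)
    then have "int n dvd (int c)\<^sup>2 * ((1 + int w)\<^sup>2 - (1 + int c * int w)) -
        int n * (int c * int w + (2 - int c) * int c - (int c + 1))"
      by simp
    also have "(int c)\<^sup>2 * ((1 + int w)\<^sup>2 - (1 + int c * int w)) -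
        int n * (int c * int w + (2 - int c) * int c - (int c + 1)) = int c ^ 3 + 1"
      unfolding nw by (simp add: algebra_simps power2_eq_square power3_eq_cube)
    finally have "int n dvd int (c ^ 3 + 1)" by (simp add: add.commute)
    then have "n dvd c ^ 3 + 1" by (simp only: int_dvd_int_iff)
    then have "n \<le> c ^ 3 + 1" by (rule dvd_imp_le) simp
    also have "c ^ 3 \<le> 4 ^ 3" using c by (intro power_mono) auto
    finally have "n \<le> 65" by simp
    moreover have "200 \<le> w" unfolding w_def using s v mult_le_mono[of 1 s 200 v] by simp
    moreover have "w \<le> c * w" using c by simp
    ultimately show False using nw by simp
  qed
  have compat: "[direction x = direction f] (mod period f)" "[direction y = direction f] (mod period f)"
      and period_dvd: "period f dvd c + 1"
    if f: "f \<in> G0" "f \<noteq> x" "f \<noteq> y" for f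
  proof -
    have fn: "period f dvd n" unfolding n_def using step_period by (metis dvd_triv_right)
    have gcds: "gcd (period x) (period f) = period f" "gcd (period y) (period f) = period f"
      using fn xy by (simp_all add: gcd_nat.absorb2)
    \<comment> \<open>For an incompatible \<open>f\<close>, being distinct from \<open>y\<close>
      leaves the ratio \<open>1 + c * w\<close> to \<open>x\<close>, and being distinct from
      \<open>x\<close> leaves the ratio \<open>1 + w\<close> to \<open>y\<close>. Together they
      contradict \<open>no_cube\<close>.\<close>
    have x_compat: "[direction x = direction f] (mod period f)"
    proof (rule ccontr)
      assume "\<not> ?thesis"
      then have pf: "period f = n" and
        "[direction f = (1 + w) * direction x] (mod n) \<or> [direction f = (1 + c * w) * direction x] (mod n)"
        using alt[OF xy(1) f(1)] gcds by auto
      then have fx: "[direction f = (1 + c * w) * direction x] (mod n)"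
        using direction_eq[OF f(1) xy(2) pf xy(4)] f(3) xy(5) cong_trans cong_sym by blast
      have "\<not> [direction y = direction f] (mod n)"
        using direction_eq[OF xy(2) f(1) xy(4) pf] f by blast
      then have "[direction f = (1 + w) * direction y] (mod n) \<or> [direction f = (1 + c * w) * direction y] (mod n)"
        using alt[OF xy(2) f(1)] gcds pf by auto
      then have "[direction f = (1 + w) * direction y] (mod n)"
        using direction_eq[OF f(1) xy(1) pf xy(3)] f(2) x_of_y cong_trans cong_sym by blast
      moreover have "[(1 + w) * direction y = (1 + w) * ((1 + w) * direction x)] (mod n)"
        using xy(5) by (rule cong_scalar_left)
      ultimately have "[(1 + w) * (1 + w) * direction x = (1 + c * w) * direction x] (mod n)"
        using fx by (metis cong_sym cong_trans mult.assoc)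
      then show False using no_cube by (simp only: cong_mult_rcancel_nat[OF cop])
    qed
    have y_compat: "[direction y = direction f] (mod period f)"
    proof (rule ccontr)
      assume "\<not> ?thesis"
      then have pf: "period f = n" using alt[OF xy(2) f(1)] gcds by auto
      then have "x = f" using direction_eq[OF xy(1) f(1) xy(3)] x_compat by simp
      then show False using f by simp
    qed
    \<comment> \<open>Compatibility with both \<open>x\<close> and \<open>y\<close> makes the ratio
      \<open>1 + w\<close> trivial modulo \<open>period f\<close>, so \<open>period f\<close>
      divides \<open>gcd w n\<close>.\<close>
    have "[direction y = (1 + w) * direction x] (mod period f)"
      using xy(5) fn by (rule cong_dvd_modulus_nat)
    then have "[(1 + w) * direction x = 1 * direction x] (mod period f)"
      using x_compat y_compat by (metis cong_sym cong_trans mult_1)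
    moreover have "coprime (direction x) (period f)"
      using cop fn by (metis coprime_divisors dvd_refl)
    ultimately have "[1 + w = 1] (mod period f)" by (simp only: cong_mult_rcancel_nat)
    then have "[1 + w = 1 + 0] (mod period f)" by simp
    then have "period f dvd w" by (simp only: cong_add_lcancel_nat cong_0_iff)
    then show "period f dvd c + 1" using ncop fn by (meson dvd_trans gcd_greatest)
    show "[direction x = direction f] (mod period f)" "[direction y = direction f] (mod period f)"
      by (fact x_compat y_compat)+
  qed
  have pow_eq: "a [^] k = b" if ab: "a \<in> G0" "b \<in> G0" "[L a * k = L b] (mod n)" for a b k
  proof -
    have "a [^] k = (e [^] L a) [^] k" using log[OF ab(1)] by simp
    also have "\<dots> = e [^] L b" unfolding nat_pow_pow[OF base_closed]
      using ab(3) by (intro pow_mod_ord[OF base_closed]) (simp add: n_def)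
    finally show ?thesis using log[OF ab(2)] by simp
  qed
  have Lxy: "L x = direction x" "L y = direction y"
    using step_direction[of x] step_direction[of y] step_period[of x] step_period[of y] xy(3,4) base_ord
    unfolding n_def by (metis mult_cancel2 mult_1 less_irrefl)+
  have carr: "a \<in> carrier G" if "a \<in> G0" for a using log[OF that] base_closed nat_pow_closed by metis
  have ords: "ord a = n" if a: "a \<in> G0" "period a = n" for a
  proof -
    have "a [^] k = \<one> \<longleftrightarrow> n dvd k" for k :: nat
    proof -
      have "a [^] k = e [^] (L a * k)" using log[OF a(1)] nat_pow_pow[OF base_closed] by metis
      then have "a [^] k = \<one> \<longleftrightarrow> ord e dvd k * L a"
        using pow_eq_id[OF base_closed] by (simp add: mult.commute)
      then show ?thesis using dvd_pow_iff a(2) by simp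
    qed
    then show ?thesis using ord_unique[OF carr[OF a(1)]] by blast
  qed
  have xny: "x \<noteq> y"
  proof
    assume "x = y"
    then have "[1 * direction x = (1 + w) * direction x] (mod n)" using xy(5) by simp
    then have "[1 = 1 + w] (mod n)" by (simp only: cong_mult_rcancel_nat[OF cop])
    then have "[1 + w = 1 + 0] (mod n)" using cong_sym by simp
    then have "n dvd w" by (simp only: cong_add_lcancel_nat cong_0_iff)
    then have "n \<le> w" using w0 by (rule dvd_imp_le)
    moreover have "w \<le> c * w" using c by simp
    ultimately show False using nw by simp
  qed
  have n0: "n > 0" unfolding n_def using base_ord .
  \<comment> \<open>As directions agree, \<open>step f\<close> is a logarithm of every further
    \<open>f\<close> to both bases.\<close>
  define Lx where "Lx a = (if a = x then 1 else if a = y then 1 + w else step a)" for a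
  define Ly where "Ly a = (if a = y then 1 else if a = x then 1 + c * w else step a)" for a
  have vals: "Lx x = 1" "Lx y = 1 + 1 * w" "Ly y = 1" "Ly x = 1 + c * w"
    unfolding Lx_def Ly_def using xny by simp_all
  have rest_pow: "[direction z * step f = L f] (mod n)" if "f \<in> G0" "f \<noteq> x" "f \<noteq> y" "z \<in> {x, y}" for f z
  proof -
    have "[direction z = direction f] (mod period f)" using compat[OF that(1-3)] that(4) by blast
    then have "[step f * direction z = step f * direction f] (mod step f * period f)"
      by (rule cong_cmult_leftI)
    then show ?thesis unfolding step_period step_direction n_def by (simp only: mult.commute)
  qed
  interpret X: log_base G G0 x Lx
  proof
    show "x [^] Lx a = a" if "a \<in> G0" for a
    proof -
      consider "a = x" | "a = y" | "a \<noteq> x" "a \<noteq> y" by blast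
      then show ?thesis
      proof cases
        case 2
        have "[L x * (1 + w) = L y] (mod n)" unfolding Lxy using xy(5) cong_sym by (metis mult.commute)
        then have "x [^] (1 + w) = y" using xy(1,2) by (intro pow_eq)
        then show ?thesis using 2 vals(2) by (simp only: mult_1)
      next
        case 3
        then have "[L x * step a = L a] (mod n)" unfolding Lxy using rest_pow that by blast
        then show ?thesis using pow_eq xy that 3 unfolding Lx_def by simp
      qed (use vals carr xy in simp)
    qed
  qed (use carr ords xy n0 in simp_all)
  interpret Y: log_base G G0 y Ly
  proof
    show "y [^] Ly a = a" if "a \<in> G0" for a
    proof -
      consider "a = y" | "a = x" | "a \<noteq> x" "a \<noteq> y" by blast
      then show ?thesis
      proof cases
        case 2
        have "[L y * (1 + c * w) = L x] (mod n)" unfolding Lxy using x_of_y cong_sym by (metis mult.commute)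
        then have "y [^] (1 + c * w) = x" using xy(1,2) by (intro pow_eq)
        then show ?thesis using 2 vals(4) by (simp only:)
      next
        case 3
        then have "[L y * step a = L a] (mod n)" unfolding Lxy using rest_pow that by blast
        then show ?thesis using pow_eq xy that 3 unfolding Ly_def by simp
      qed (use vals carr xy in simp)
    qed
  qed (use carr ords xy n0 in simp_all)
  \<comment> \<open>The number \<open>c + 1\<close> is one of 2, 3, 4, 5, hence a prime power, and
    its divisors form a chain; the complementary steps form the reversed chain.\<close>
  have div_chain: "b dvd a" if "a dvd c + 1" "b dvd c + 1" "b \<le> a" for a b :: nat
  proof -
    have "c \<in> {1,2,3,4}" using c by auto
    moreover have "a \<le> c + 1" "b \<le> c + 1" "a > 0" "b > 0"
      using that by (auto intro: dvd_imp_le Nat.gr0I)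
    then have "a \<in> {1,2,3,4,5}" "b \<in> {1,2,3,4,5}" using c by auto
    ultimately show ?thesis using that by - (elim insertE emptyE; simp; presburger)
  qed
  interpret two_base G G0 x Lx y Ly n 1 c w
  proof
    show "Ly f = Lx f \<and> 0 < Lx f \<and> Lx f dvd n" if "f \<in> G0 - {x, y}" for f
      using that step_pos step_period[of f] unfolding Lx_def Ly_def n_def by (auto, metis dvd_triv_left)
    show "Lx f dvd Lx f'" if "f \<in> G0 - {x, y}" "f' \<in> G0 - {x, y}" "Lx f \<le> Lx f'" for f f'
    proof -
      have le: "step f \<le> step f'" using that unfolding Lx_def by auto
      have eq: "step f * period f = step f' * period f'" by (simp add: step_period)
      have "period f' \<le> period f"
      proof (rule ccontr)
        assume "\<not> ?thesis"
        then have "step f * period f < step f' * period f'"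
          using le step_pos[of f] by (intro mult_le_less_imp_less) auto
        then show False using eq by simp
      qed
      then have "period f' dvd period f" using div_chain period_dvd that by auto
      then obtain k where "period f = period f' * k" by blast
      then have "step f * k = step f'" using eq period_pos[of f'] by simp
      then have "step f dvd step f'" by (rule dvdI[OF sym])
      then show ?thesis using that unfolding Lx_def by auto
    qed
  qed (use nw c w0 ords xy xny vals in simp_all)
  obtain B l where l: "l \<in> lengths G G0 B" "l + v \<in> lengths G G0 B"
    using least_Delta_pos(1)[OF ne] unfolding v_def by blast
  \<comment> \<open>As \<open>period f\<close> divides \<open>c + 1\<close>, the factor
    \<open>c + 1\<close> turns each \<open>step f\<close> into a multiple of
    \<open>n\<close>.\<close>
  have "[(c + 1) * (l + v) = (c + 1) * l] (mod w)"
  proof (rule lengths_cong_two_base[OF _ _ l(2,1)])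
    fix f assume f: "f \<in> G0 - {x, y}"
    then obtain k where k: "c + 1 = period f * k" using period_dvd by blast
    have "Lx f = step f" using f unfolding Lx_def by auto
    then have "(c + 1) * (1 * w * Lx f) = (step f * period f) * w * k" unfolding k by simp
    then show "n * w dvd (c + 1) * (1 * w * Lx f)" unfolding step_period n_def by simp
  qed simp
  then have "[(c + 1) * l + (c + 1) * v = (c + 1) * l + 0] (mod w)" by (simp add: algebra_simps)
  then have "w dvd (c + 1) * v" by (simp only: cong_add_lcancel_nat cong_0_iff)
  then have "s dvd c + 1"
    unfolding w_def using v by (metis dvd_mult_cancel2 dvd_times_right_cancel_iff less_le_trans
        not_less_zero zero_less_numeral)
  moreover have "\<not> s dvd c + 1"
  proof -
    have "s \<le> c + 1" if "s dvd c + 1" using that by (rule dvd_imp_le) simp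
    then show ?thesis using exc unfolding exceptional_def by (auto; presburger)
  qed
  ultimately show False by blast
qed

end

section \<open>The converse inclusion for large values, and the theorem\<close>

lemma Delta_star_imp_I_set:
  fixes G :: "('a, 'b) monoid_scheme" (structure)
  assumes G: "group G" "cyclic_group G" "finite (carrier G)" and n: "order G \<ge> 2000"
    and v: "v \<in> Delta_star G" "10 * v \<ge> order G"
  shows "\<exists>m. m dvd order G \<and> v \<in> I_set m"
proof -
  interpret comm_group G using group.cyclic_imp_abelian_group G by blast
  obtain G0 where G0: "G0 \<subseteq> carrier G" "Delta G G0 \<noteq> {}" "v = (LEAST d. d \<in> Delta G G0)"
    using v(1) unfolding Delta_star_def by blast
  obtain z where z: "z \<in> carrier G" "ord z = order G" using ex_generator G(2) by blast
  have "\<forall>x\<in>G0. \<exists>k::nat. z [^] k = x" using ex_log[OF z G(3)] G0(1) by blast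
  then obtain L :: "'a \<Rightarrow> nat" where L: "\<And>x. x \<in> G0 \<Longrightarrow> z [^] L x = x" by metis
  interpret log_base G G0 z L using z n L by unfold_locales auto
  have v200: "v \<ge> 200" using n v by linarith
  have cong: "[l = l'] (mod v)" if "l \<in> lengths G G0 B" "l' \<in> lengths G G0 B" for l l' B
    using least_Delta_dvd[OF G0(2) that] G0(3) by simp
  have "\<exists>g\<in>G0. \<exists>h\<in>G0. \<not> [direction g = direction h] (mod gcd (period g) (period h))"
  proof (rule ccontr)
    assume "\<not> ?thesis"
    then have "v \<le> card {d. d dvd order G}"
      using least_Delta_le_card_divisors G(3) G0 finite_subset z by metis
    \<comment> \<open>With \<open>k = 20\<close> this gives \<open>20 * v <= n + 400\<close>,
      whereas \<open>20 * v >= 2 * n\<close> and \<open>n >= 2000\<close>.\<close>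
    also have "\<dots> \<le> order G div 20 + 20" using n by (intro card_divisors_le) auto
    finally have "20 * v \<le> order G + 400" by linarith
    then show False using v n by linarith
  qed
  then obtain g h where gh: "g \<in> G0" "h \<in> G0"
    and nc: "\<not> [direction g = direction h] (mod gcd (period g) (period h))" by blast
  define d where "d = gcd (period g) (period h)"
  have "\<exists>q r s. q > 0 \<and> r > 0 \<and> s > 0 \<and> d = q * (1 + r * s * v) + r \<and>
      [direction h = (1 + r * s * v) * direction g] (mod d)"
    unfolding d_def using v v200 z by (intro incompatible_pair[OF cong _ _ gh nc]) auto
  then obtain q r s where qrs: "q > 0" "r > 0" "s > 0" "d = q * (1 + r * s * v) + r" by blast
  have "d dvd order G"
    unfolding d_def using step_period[of g] z(2) by (metis dvd_trans dvd_triv_right gcd_dvd1)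
  then obtain R where R: "order G = R * d" by (metis dvd_def mult.commute)
  have R0: "R > 0" using R n by (auto intro: Nat.gr0I)
  have deq: "order G = R * (q * r * s * v + q + r)"
    unfolding R qrs(4) by (simp add: algebra_simps)
  have "R * q * r * s * v < R * (q * r * s * v + q + r)"
    using R0 qrs by (simp add: algebra_simps)
  also have "\<dots> \<le> 10 * v" using deq v by simp
  finally have "R * q * r * s \<le> 9" using v200 by simp
  then have "(\<exists>m. m dvd order G \<and> v \<in> I_set m) \<or>
      (\<exists>c. exceptional c s \<and> order G = c * s * v + c + 1)"
    using R0 qrs(1-3) v200 deq by (intro I_set_or_exceptional) auto
  moreover have False if "exceptional c s" "order G = c * s * v + c + 1" for c
    using not_exceptional[OF G0(2) _ _ that(1) _ gh nc] that(2) v v200 z G0(3) by simp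
  ultimately show ?thesis by blast
qed

theorem theorem7p3:
  fixes G :: "'a monoid"
  assumes "group G" and "cyclic_group G" and "finite (carrier G)"
    and "order G \<ge> 2000"
  shows "Delta_star G \<inter> {k. real k \<ge> real (order G) / 10} =
         (\<Union>m \<in> {m. m dvd order G}. I_set m) \<inter> {k. real k \<ge> real (order G) / 10}"
proof -
  have "v \<in> (\<Union>m \<in> {m. m dvd order G}. I_set m)"
    if "v \<in> Delta_star G" "real v \<ge> real (order G) / 10" for v
  proof -
    have "real (order G) \<le> real (10 * v)" using that(2) by simp
    then have "order G \<le> 10 * v" by (simp only: of_nat_le_iff)
    then show ?thesis using Delta_star_imp_I_set[OF assms that(1)] by blast
  qed
  moreover have "v \<in> Delta_star G" if "v \<in> I_set m" "m dvd order G" for v m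
    using I_set_subset_Delta_star assms that by blast
  ultimately show ?thesis by blast
qed

end
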